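(* Let $d\ge 3$. The degree of the homogeneous ideal $\mathcal{I}(\mathcal{M}^{\mathrm{IG}}_d)\subseteq\mathbb{C}[m_0,\ldots,m_d]$ of the $d$th inverse Gaussian moment variety is $$\deg(\mathcal{I}(\mathcal{M}^{\mathrm{IG}}_d))=(d-1)^2.$$
   Context: The moments of the inverse Gaussian distribution with parameters $\mu,\lambda$ are given by $m_0=1$, $m_1=\mu$, and $m_i=\frac{2i-3}{\lambda}\mu^2 m_{i-1}+\mu^2 m_{i-2}$ for $i\geq 2$. The inverse Gaussian moment variety $\mathcal{M}^{\mathrm{IG}}_d\subseteq\mathbb{P}^d$ is the Zariski closure of the set of points $[m_0(\mu,\lambda):m_1(\mu,\lambda):\cdots:m_d(\mu,\lambda)]$ with $\mu\in\mathbb{C}$, $\lambda\in\mathbb{C}\setminus\{0\}$ (complex projective space with homogeneous coordinates $m_0,\dots,m_d$). $\mathcal{I}(V)$ denotes the homogeneous vanishing ideal of a projective variety $V$, and the degree of a homogeneous ideal $I$ is the degree (multiplicity) of the standard graded ring $\mathbb{C}[m_0,\ldots,m_d]/I$. *)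

theory Defs
  imports
    "HOL-Library.Poly_Mapping"
    "HOL-Computational_Algebra.Polynomial"
    "HOL-Algebra.Embedded_Algebras"
begin

section \<open>The polynomial ring in the variables of index 0 to d over the complex numbers\<close>

type_synonym mpoly = "(nat \<Rightarrow>\<^sub>0 nat) \<Rightarrow>\<^sub>0 complex"

definition monom_degree :: "(nat \<Rightarrow>\<^sub>0 nat) \<Rightarrow> nat" where
  "monom_degree m = (\<Sum>i\<in>Poly_Mapping.keys m. Poly_Mapping.lookup m i)"

definition mpolys :: "nat \<Rightarrow> mpoly set" where
  "mpolys d = {p. \<forall>m\<in>Poly_Mapping.keys p. Poly_Mapping.keys m \<subseteq> {..d}}"

definition mpoly_ring :: "nat \<Rightarrow> mpoly ring" where
  "mpoly_ring d = \<lparr>carrier = mpolys d, mult = (*), one = 1, zero = 0, add = (+)\<rparr>"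

lemma cring_mpoly_ring: "cring (mpoly_ring d)"
proof (rule cringI)
  have plus: "p + q \<in> mpolys d" if "p \<in> mpolys d" "q \<in> mpolys d" for p q
    using that Poly_Mapping.keys_add[of p q] unfolding mpolys_def by blast
  have times: "p * q \<in> mpolys d" if "p \<in> mpolys d" "q \<in> mpolys d" for p q
  proof -
    have "Poly_Mapping.keys m \<subseteq> {..d}" if m: "m \<in> Poly_Mapping.keys (p * q)" for m
    proof -
      from m obtain a b where ab: "m = a + b" "a \<in> Poly_Mapping.keys p" "b \<in> Poly_Mapping.keys q"
        using Poly_Mapping.keys_mult[of p q] by blast
      have "Poly_Mapping.keys a \<subseteq> {..d}" "Poly_Mapping.keys b \<subseteq> {..d}"
        using ab \<open>p \<in> mpolys d\<close> \<open>q \<in> mpolys d\<close> unfolding mpolys_def by blast+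
      then show ?thesis
        using Poly_Mapping.keys_add[of a b] ab(1) by blast
    qed
    then show ?thesis
      unfolding mpolys_def by blast
  qed
  have uminus: "- p \<in> mpolys d" if "p \<in> mpolys d" for p
    using that by (simp add: mpolys_def)
  have zero: "0 \<in> mpolys d"
    by (simp add: mpolys_def)
  have one: "1 \<in> mpolys d"
    by (simp add: mpolys_def)
  show "abelian_group (mpoly_ring d)"
    by (rule abelian_groupI)
      (auto simp: mpoly_ring_def plus zero algebra_simps
        intro!: bexI[of _ "- p" for p] uminus)
  show "Group.comm_monoid (mpoly_ring d)"
    by (rule comm_monoidI) (auto simp: mpoly_ring_def times one algebra_simps)
qed (auto simp: mpoly_ring_def algebra_simps)

definition constants :: "mpoly set" where
  "constants = range (Poly_Mapping.single 0)"

text \<open>Homogeneous polynomials of degree n, together with 0.\<close>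

definition forms :: "nat \<Rightarrow> nat \<Rightarrow> mpoly set" where
  "forms d n = {p \<in> mpolys d. \<forall>m\<in>Poly_Mapping.keys p. monom_degree m = n}"

definition eval_mpoly :: "(nat \<Rightarrow> complex) \<Rightarrow> mpoly \<Rightarrow> complex" where
  "eval_mpoly x p = (\<Sum>m\<in>Poly_Mapping.keys p. Poly_Mapping.lookup p m * (\<Prod>i\<in>Poly_Mapping.keys m. x i ^ Poly_Mapping.lookup m i))"


section \<open>Projective varieties\<close>

text \<open>A point of projective d-space is represented by the set of all of its homogeneous
  coordinate vectors; a coordinate vector is a function on the natural numbers that is 0
  beyond the index d.\<close>

type_synonym ppoint = "(nat \<Rightarrow> complex) set"

definition proj_point :: "(nat \<Rightarrow> complex) \<Rightarrow> ppoint" where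
  "proj_point x = {(\<lambda>i. c * x i) | c. c \<noteq> 0}"

definition proj_space :: "nat \<Rightarrow> ppoint set" where
  "proj_space d = {proj_point x | x. (\<forall>i>d. x i = 0) \<and> (\<exists>i. x i \<noteq> 0)}"

definition vanishes_at :: "mpoly \<Rightarrow> ppoint \<Rightarrow> bool" where
  "vanishes_at f P \<longleftrightarrow> (\<forall>x\<in>P. eval_mpoly x f = 0)"

definition zero_locus :: "nat \<Rightarrow> mpoly set \<Rightarrow> ppoint set" where
  "zero_locus d F = {P \<in> proj_space d. \<forall>f\<in>F. vanishes_at f P}"

definition zariski_closed :: "nat \<Rightarrow> ppoint set \<Rightarrow> bool" where
  "zariski_closed d Z \<longleftrightarrow> (\<exists>F \<subseteq> (\<Union>n. forms d n). Z = zero_locus d F)"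

definition zariski_closure :: "nat \<Rightarrow> ppoint set \<Rightarrow> ppoint set" where
  "zariski_closure d S = \<Inter>{Z. zariski_closed d Z \<and> S \<subseteq> Z}"

definition vanishing_ideal :: "nat \<Rightarrow> ppoint set \<Rightarrow> mpoly set" where
  "vanishing_ideal d V =
     Idl\<^bsub>mpoly_ring d\<^esub> {f \<in> (\<Union>n. forms d n). \<forall>P\<in>V. vanishes_at f P}"


section \<open>Degree of a homogeneous ideal\<close>

text \<open>For a proper homogeneous ideal I, this is the complex dimension of the degree n part of
  the graded ring R/I: that part is the image of the forms of degree n, and the base field
  is embedded in R/I as the image of the constants.\<close>

definition hilbert_function :: "nat \<Rightarrow> mpoly set \<Rightarrow> nat \<Rightarrow> nat" where
  "hilbert_function d I n =
     (let q = (\<lambda>p. I +>\<^bsub>mpoly_ring d\<^esub> p)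
      in ring.dim (mpoly_ring d Quot I) (q ` constants) (q ` forms d n))"

definition hilbert_polynomial :: "nat \<Rightarrow> mpoly set \<Rightarrow> rat poly" where
  "hilbert_polynomial d I =
     (THE P. \<forall>\<^sub>F n in sequentially. of_nat (hilbert_function d I n) = poly P (of_nat n))"

text \<open>The multiplicity of R/I: if the Hilbert polynomial is nonzero of degree r, it is r! times
  the leading coefficient; if the Hilbert polynomial is 0, then R/I is Artinian and its
  multiplicity is its length.\<close>

definition ideal_degree :: "nat \<Rightarrow> mpoly set \<Rightarrow> rat" where
  "ideal_degree d I =
     (let P = hilbert_polynomial d I
      in if P = 0 then of_nat (\<Sum>n | hilbert_function d I n \<noteq> 0. hilbert_function d I n)
         else fact (Polynomial.degree P) * lead_coeff P)"


section \<open>The inverse Gaussian moment variety\<close>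

fun ig_moment :: "complex \<Rightarrow> complex \<Rightarrow> nat \<Rightarrow> complex" where
  "ig_moment \<mu> l 0 = 1"
| "ig_moment \<mu> l (Suc 0) = \<mu>"
| "ig_moment \<mu> l (Suc (Suc i)) =
     (2 * of_nat (Suc (Suc i)) - 3) / l * \<mu>^2 * ig_moment \<mu> l (Suc i) + \<mu>^2 * ig_moment \<mu> l i"

definition ig_moment_point :: "nat \<Rightarrow> complex \<Rightarrow> complex \<Rightarrow> ppoint" where
  "ig_moment_point d \<mu> l = proj_point (\<lambda>i. if i \<le> d then ig_moment \<mu> l i else 0)"

definition ig_moment_variety :: "nat \<Rightarrow> ppoint set" where
  "ig_moment_variety d = zariski_closure d {ig_moment_point d \<mu> l | \<mu> l. l \<noteq> 0}"

end

theory Submission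
  imports Defs
    "HOL-Computational_Algebra.Polynomial_Factorial"
    "HOL-Computational_Algebra.Field_as_Ring"
begin

text \<open>With \<open>y = \<mu> / \<lambda>\<close> the moments are \<open>m\<^sub>i = \<mu>\<^sup>i B\<^sub>i(y)\<close> for polynomials \<open>B\<^sub>i\<close> of degree \<open>i - 1\<close>
  in which neighbours are coprime. The Hilbert function at \<open>n\<close> is therefore the dimension of the span of
  the products of \<open>n\<close> of these polynomials in \<open>\<mu>\<close> and \<open>y\<close>. It is the number of standard monomials
  of degree \<open>n\<close>, and as divisors of standard monomials are standard, Dickson's lemma makes it
  eventually a polynomial; hence it suffices to know it up to \<open>O(n)\<close>.

  In \<open>\<mu>\<close>-degree \<open>w\<close> a product of \<open>n\<close> moments has \<open>y\<close>-degree at most \<open>w (d - 1) / d\<close> and is divisible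
  by the power \<open>n - (n d - w)\<close> of \<open>B\<^sub>d\<close>; summing over \<open>w\<close> gives the upper bound
  \<open>(d - 1)\<^sup>2 n\<^sup>2 / 2 + O(n)\<close>. Conversely, \<open>y\<close> is the quotient of the products \<open>m\<^sub>0 m\<^sub>2 - m\<^sub>1\<^sup>2\<close> and
  \<open>m\<^sub>1\<^sup>2\<close>, and \<open>1, y, y\<^sup>2, \<dots>\<close> up to the exponent \<open>(d - 1)\<^sup>2 - 1\<close> are linearly independent over the
  polynomials in \<open>m\<^sub>0, m\<^bsub>d-1\<^esub>, m\<^sub>d\<close>, which gives the matching lower bound.\<close>

section \<open>Numerical polynomials\<close>

definition eventually_poly :: "(nat \<Rightarrow> rat) \<Rightarrow> bool" where
  "eventually_poly c \<longleftrightarrow> (\<exists>P. \<forall>\<^sub>F n in sequentially. c n = poly P (of_nat n))"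

lemma eventually_poly_add:
  assumes "eventually_poly c" "eventually_poly c'"
  shows "eventually_poly (\<lambda>n. c n + c' n)"
proof -
  obtain P Q where "\<forall>\<^sub>F n in sequentially. c n = poly P (of_nat n)"
    "\<forall>\<^sub>F n in sequentially. c' n = poly Q (of_nat n)"
    using assms unfolding eventually_poly_def by blast
  then have "\<forall>\<^sub>F n in sequentially. c n + c' n = poly (P + Q) (of_nat n)"
    by eventually_elim simp
  then show ?thesis unfolding eventually_poly_def by blast
qed

lemma eventually_poly_sum:
  assumes "\<And>j. j \<in> A \<Longrightarrow> eventually_poly (c j)"
  shows "eventually_poly (\<lambda>n. \<Sum>j\<in>A. c j n)"
  using assms
proof (induction A rule: infinite_finite_induct)
  case (insert x A)
  then show ?case by (simp add: eventually_poly_add)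
qed (auto simp: eventually_poly_def intro!: exI[of _ 0])

lemma eventually_poly_shift:
  assumes "eventually_poly c"
  shows "eventually_poly (\<lambda>n. c (n - j))"
proof -
  obtain P where "\<forall>\<^sub>F n in sequentially. c n = poly P (of_nat n)"
    using assms unfolding eventually_poly_def by blast
  then obtain N where N: "\<And>n. n \<ge> N \<Longrightarrow> c n = poly P (of_nat n)"
    unfolding eventually_sequentially by blast
  \<comment> \<open>The bound \<open>N + j\<close> makes the subtraction on naturals exact, so
    composition with X - j realises the shift.\<close>
  have "c (n - j) = poly (pcompose P [:- of_nat j, 1:]) (of_nat n)" if "n \<ge> N + j" for n
    using N[of "n - j"] that by (simp add: poly_pcompose of_nat_diff algebra_simps)
  then show ?thesis unfolding eventually_poly_def eventually_sequentially by blast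
qed

lemma eventually_poly_cong:
  assumes "\<And>n. n \<ge> N \<Longrightarrow> c n = c' n" "eventually_poly c'"
  shows "eventually_poly c"
proof -
  obtain P where "\<forall>\<^sub>F n in sequentially. c' n = poly P (of_nat n)"
    using assms(2) unfolding eventually_poly_def by blast
  moreover have "\<forall>\<^sub>F n in sequentially. c n = c' n"
    using assms(1) eventually_sequentially by blast
  ultimately have "\<forall>\<^sub>F n in sequentially. c n = poly P (of_nat n)"
    by eventually_elim simp
  then show ?thesis unfolding eventually_poly_def by blast
qed

text \<open>The falling factorial x (x - 1) ... (x - k + 1). Its partial sums are again multiples of
  a falling factorial, which makes it the convenient basis for summation.\<close>

definition falling_poly :: "nat \<Rightarrow> 'a::field_char_0 poly" where
  "falling_poly k = (\<Prod>i<k. [:- of_nat i, 1:])"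

lemma degree_falling_poly: "degree (falling_poly k :: 'a::field_char_0 poly) = k"
  and lead_coeff_falling_poly: "lead_coeff (falling_poly k :: 'a poly) = 1"
proof -
  show "degree (falling_poly k :: 'a poly) = k"
    unfolding falling_poly_def by (simp add: degree_prod_eq_sum_degree)
  show "lead_coeff (falling_poly k :: 'a poly) = 1"
    unfolding falling_poly_def lead_coeff_prod by simp
qed

lemma poly_falling_poly_add_1:
  "poly (falling_poly (Suc k)) (x + 1) = (x + 1) * poly (falling_poly k) x"
  unfolding falling_poly_def poly_prod
  by (subst prod.lessThan_Suc_shift) (simp add: add.commute)

lemma sum_poly_falling_poly:
  "(\<Sum>i<n. poly (falling_poly k) (of_nat i)) = poly (falling_poly (Suc k)) (of_nat n) / (of_nat (Suc k) :: 'a::field_char_0)"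
proof (induction n)
  case 0
  have "poly (falling_poly (Suc k)) (0::'a) = 0"
    unfolding falling_poly_def poly_prod by (subst prod.lessThan_Suc_shift) simp
  then show ?case by simp
next
  case (Suc n)
  have "(of_nat (Suc k) :: 'a) \<noteq> 0" by (rule of_nat_neq_0)
  moreover have "poly (falling_poly (Suc k)) (of_nat (Suc n)) = (of_nat n + 1) * poly (falling_poly k) (of_nat n :: 'a)"
    using poly_falling_poly_add_1[of k "of_nat n :: 'a"] by (simp add: add.commute)
  moreover have "poly (falling_poly (Suc k)) (of_nat n) = poly (falling_poly k) (of_nat n) * (of_nat n - of_nat k :: 'a)"
    by (simp add: falling_poly_def poly_prod algebra_simps)
  ultimately show ?case
    using Suc by (simp add: field_simps)
qed

text \<open>Induction on the degree: subtracting the falling factorial with the same leading term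
  lowers the degree, and the subtracted part is summed by
  \<open>sum_poly_falling_poly\<close>.\<close>

lemma sum_poly_is_poly:
  fixes P :: "'a::field_char_0 poly"
  shows "\<exists>Q. \<forall>n. (\<Sum>i<n. poly P (of_nat i)) = poly Q (of_nat n)"
proof (induction "degree P" arbitrary: P rule: less_induct)
  case less
  define k where "k = degree P"
  define R where "R = P - Polynomial.smult (lead_coeff P) (falling_poly k)"
  have "\<exists>Q. \<forall>n. (\<Sum>i<n. poly R (of_nat i)) = poly Q (of_nat n)"
  proof (cases "k = 0")
    case True
    then have "R = 0"
      unfolding R_def k_def falling_poly_def by (auto elim!: degree_eq_zeroE)
    then show ?thesis by (intro exI[of _ 0]) simp
  next
    case False
    have "degree R \<le> k"
      unfolding R_def k_def
      by (rule degree_diff_le) (simp_all add: degree_falling_poly)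
    moreover have "poly.coeff R k = 0"
      using lead_coeff_falling_poly[of k, where 'a='a]
      by (simp add: R_def k_def degree_falling_poly)
    ultimately have "R = 0 \<or> degree R < k"
      by (simp add: eq_zero_or_degree_less)
    then show ?thesis
      using less[of R] k_def by (cases "R = 0") (auto intro: exI[of _ 0])
  qed
  then obtain Q where Q: "\<And>n. (\<Sum>i<n. poly R (of_nat i)) = poly Q (of_nat n)" by blast
  have "(\<Sum>i<n. poly P (of_nat i)) =
      poly (Q + Polynomial.smult (lead_coeff P / of_nat (Suc k)) (falling_poly (Suc k))) (of_nat n)" for n
  proof -
    have "poly P x = poly R x + lead_coeff P * poly (falling_poly k) x" for x
      by (simp add: R_def)
    then have "(\<Sum>i<n. poly P (of_nat i)) = poly Q (of_nat n) + lead_coeff P * (\<Sum>i<n. poly (falling_poly k) (of_nat i))"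
      by (simp add: sum.distrib Q sum_distrib_left)
    then show ?thesis
      by (subst (asm) sum_poly_falling_poly) simp
  qed
  then show ?case by blast
qed

lemma eventually_poly_partial_sums:
  assumes "eventually_poly c"
  shows "eventually_poly (\<lambda>n. \<Sum>i\<le>n. c i)"
proof -
  obtain P where "\<forall>\<^sub>F n in sequentially. c n = poly P (of_nat n)"
    using assms unfolding eventually_poly_def by blast
  then obtain N where N: "\<And>n. n \<ge> N \<Longrightarrow> c n = poly P (of_nat n)"
    unfolding eventually_sequentially by blast
  obtain Q where Q: "\<And>n. (\<Sum>i<n. poly P (of_nat i)) = poly Q (of_nat n)"
    using sum_poly_is_poly by blast
  \<comment> \<open>The sequence and the polynomial differ only before \<open>N\<close>, so from
    there on their partial sums differ by the constant \<open>e\<close>. Composing with 1 + X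
    accounts for including the index \<open>n\<close>.\<close>
  define e where "e = (\<Sum>i<N. c i - poly P (of_nat i))"
  have "(\<Sum>i\<le>n. c i) = poly (pcompose Q [:1, 1:] + [:e:]) (of_nat n)" if "n \<ge> N" for n
  proof -
    have "(\<Sum>i\<le>n. c i) - (\<Sum>i\<le>n. poly P (of_nat i)) = (\<Sum>i\<le>n. c i - poly P (of_nat i))"
      by (simp add: sum_subtractf)
    also have "\<dots> = e"
      unfolding e_def using that N by (intro sum.mono_neutral_right) auto
    finally show ?thesis
      using Q[of "Suc n"] by (simp add: poly_pcompose lessThan_Suc_atMost algebra_simps)
  qed
  then show ?thesis unfolding eventually_poly_def eventually_sequentially by blast
qed

section \<open>Counting the monomials outside a monomial ideal\<close>

lemma monom_degree_eq_sum:
  assumes "finite A" "Poly_Mapping.keys m \<subseteq> A"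
  shows "monom_degree m = (\<Sum>i\<in>A. Poly_Mapping.lookup m i)"
  unfolding monom_degree_def using assms
  by (intro sum.mono_neutral_left) (auto simp: in_keys_iff)

lemma monom_degree_add: "monom_degree (a + b) = monom_degree a + monom_degree b"
proof -
  let ?A = "Poly_Mapping.keys a \<union> Poly_Mapping.keys b"
  have "Poly_Mapping.keys (a + b) \<subseteq> ?A"
    by (rule Poly_Mapping.keys_add)
  then show ?thesis
    by (simp add: monom_degree_eq_sum[of ?A] lookup_add sum.distrib)
qed

lemma monom_degree_single [simp]: "monom_degree (Poly_Mapping.single i k) = k"
  by (simp add: monom_degree_def)

definition monomials :: "nat \<Rightarrow> (nat \<Rightarrow>\<^sub>0 nat) set" where
  "monomials k = {m. Poly_Mapping.keys m \<subseteq> {..<k}}"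

lemma monomials_0: "monomials 0 = {0}"
  by (auto simp: monomials_def)

lemma zero_in_monomials [simp]: "0 \<in> monomials k"
  by (simp add: monomials_def)

lemma add_in_monomials_iff: "a + b \<in> monomials k \<longleftrightarrow> a \<in> monomials k \<and> b \<in> monomials k"
proof -
  have "Poly_Mapping.keys (a + b) = Poly_Mapping.keys a \<union> Poly_Mapping.keys b"
    by (auto simp: in_keys_iff lookup_add)
  then show ?thesis by (simp add: monomials_def)
qed

lemma single_in_monomials: "i < k \<Longrightarrow> Poly_Mapping.single i j \<in> monomials k"
  by (auto simp: monomials_def)

text \<open>Sorting monomials by the exponent of the last variable allows induction on the number of
  variables.\<close>

definition slice :: "nat \<Rightarrow> (nat \<Rightarrow>\<^sub>0 nat) set \<Rightarrow> nat \<Rightarrow> (nat \<Rightarrow>\<^sub>0 nat) set" where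
  "slice k C j = {m \<in> monomials k. m + Poly_Mapping.single k j \<in> C}"

text \<open>Sets of this kind are the complements of monomial ideals within the set of all
  monomials.\<close>

definition divisor_closed :: "(nat \<Rightarrow>\<^sub>0 nat) set \<Rightarrow> bool" where
  "divisor_closed C \<longleftrightarrow> (\<forall>a b. a + b \<in> C \<longrightarrow> a \<in> C)"

lemma slice_subset: "slice k C j \<subseteq> monomials k"
  by (auto simp: slice_def)

lemma divisor_closed_slice: "divisor_closed C \<Longrightarrow> divisor_closed (slice k C j)"
  unfolding divisor_closed_def slice_def
  by (auto simp: add_in_monomials_iff) (metis add.assoc add.commute)

lemma slice_antimono:
  assumes "divisor_closed C" "i \<le> j"
  shows "slice k C j \<subseteq> slice k C i"
proof
  fix m assume m: "m \<in> slice k C j"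
  have "m + Poly_Mapping.single k j = (m + Poly_Mapping.single k i) + Poly_Mapping.single k (j - i)"
    using assms(2) by (simp add: add.assoc flip: single_add)
  then show "m \<in> slice k C i"
    using m assms(1) unfolding divisor_closed_def slice_def by (metis (mono_tags, lifting) mem_Collect_eq)
qed

lemma monomials_Suc_decompose:
  assumes "m \<in> monomials (Suc k)"
  obtains m' j where "m' \<in> monomials k" "m = m' + Poly_Mapping.single k j"
proof
  let ?j = "Poly_Mapping.lookup m k"
  show "Poly_Mapping.update k 0 m \<in> monomials k"
    using assms by (auto simp: monomials_def keys_update less_Suc_eq)
  show "m = Poly_Mapping.update k 0 m + Poly_Mapping.single k ?j"
    by (rule poly_mapping_eqI) (simp add: lookup_add lookup_update lookup_single)
qed

lemma add_single_eq_iff: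
  assumes "m \<in> monomials k" "m' \<in> monomials k"
  shows "m + Poly_Mapping.single k j = m' + Poly_Mapping.single k j' \<longleftrightarrow> m = m' \<and> j = j'"
proof
  assume eq: "m + Poly_Mapping.single k j = m' + Poly_Mapping.single k j'"
  have "Poly_Mapping.lookup m k = 0" "Poly_Mapping.lookup m' k = 0"
    using assms by (auto simp: monomials_def in_keys_iff)
  then have "j = j'"
    using arg_cong[OF eq, of "\<lambda>p. Poly_Mapping.lookup p k"] by (simp add: lookup_add)
  then show "m = m' \<and> j = j'" using eq by simp
qed simp

lemma monomials_subset_by_slices:
  assumes "C \<subseteq> monomials (Suc k)" "\<And>j. slice k C j \<subseteq> slice k C' j"
  shows "C \<subseteq> C'"
proof
  fix m assume m: "m \<in> C"
  then obtain m' j where "m' \<in> monomials k" "m = m' + Poly_Mapping.single k j"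
    using assms(1) monomials_Suc_decompose by blast
  then show "m \<in> C'" using m assms(2)[of j] by (auto simp: slice_def)
qed

text \<open>Dickson's lemma, as a chain condition.\<close>

lemma divisor_closed_chain_stabilises:
  fixes D :: "nat \<Rightarrow> (nat \<Rightarrow>\<^sub>0 nat) set"
  assumes "\<And>i. D i \<subseteq> monomials k" "\<And>i. divisor_closed (D i)" "antimono D"
  shows "\<exists>N. \<forall>i\<ge>N. D i = D N"
  using assms
proof (induction k arbitrary: D)
  case 0
  show ?case
  proof (cases "\<exists>N. D N = {}")
    case True
    then obtain N where "D N = {}" ..
    then have "\<forall>i\<ge>N. D i = D N"
      using antimonoD[OF 0(3)] by blast
    then show ?thesis ..
  next
    case False
    then have "D i = {0}" for i
      using 0(1)[of i] by (auto simp: monomials_0)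
    then show ?thesis by auto
  qed
next
  case (Suc k)
  define S where "S i j = slice k (D i) j" for i j
  have anti: "S i' j' \<subseteq> S i j" if "i \<le> i'" "j \<le> j'" for i i' j j'
  proof -
    have "S i' j' \<subseteq> S i' j"
      unfolding S_def using Suc.prems(2) that(2) by (rule slice_antimono)
    also have "\<dots> \<subseteq> S i j"
      unfolding S_def slice_def using antimonoD[OF Suc.prems(3) that(1)] by blast
    finally show ?thesis .
  qed
  have chain: "\<exists>N. \<forall>i\<ge>N. S (f i) (g i) = S (f N) (g N)" if "mono f" "mono g" for f g :: "nat \<Rightarrow> nat"
  proof (rule Suc.IH[where D = "\<lambda>i. S (f i) (g i)"])
    show "S (f i) (g i) \<subseteq> monomials k" "divisor_closed (S (f i) (g i))" for i
      using Suc.prems(2) by (simp_all add: S_def slice_subset divisor_closed_slice)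
    show "antimono (\<lambda>i. S (f i) (g i))"
      by (rule antimonoI) (simp add: anti monoD[OF that(1)] monoD[OF that(2)])
  qed
  \<comment> \<open>\<open>S\<close> decreases in both indices and its diagonal settles at
    \<open>N\<close>. For \<open>j \<ge> N\<close>, a late \<open>S a j\<close> lies between two
    diagonal sets, both equal to \<open>S N N\<close>. Only the finitely many columns below
    \<open>N\<close> remain, and \<open>M\<close> waits for each of them.\<close>
  obtain N where N: "\<And>i. i \<ge> N \<Longrightarrow> S i i = S N N"
    using chain[of id id] by (auto simp: mono_def)
  have "\<exists>n. \<forall>i\<ge>n. S i j = S n j" for j
    using chain[of id "\<lambda>_. j"] by (auto simp: mono_def)
  then obtain n where n: "\<And>j i. i \<ge> n j \<Longrightarrow> S i j = S (n j) j"
    by metis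
  define M where "M = Max (insert N (n ` {..<N}))"
  have M: "M \<ge> N" "\<And>j. j < N \<Longrightarrow> M \<ge> n j"
    by (auto simp: M_def)
  have stable: "S i j = S M j" if "i \<ge> M" for i j
  proof (cases "j < N")
    case True
    then show ?thesis using n[of j i] n[of j M] M that by fastforce
  next
    case False
    have "S a j = S N N" if "a \<ge> M" for a
    proof
      show "S a j \<subseteq> S N N" using that False M by (intro anti) auto
      have "S (max a j) (max a j) \<subseteq> S a j" by (intro anti) auto
      then show "S N N \<subseteq> S a j" using N[of "max a j"] False by simp
    qed
    then show ?thesis using that by blast
  qed
  have "D i = D M" if "i \<ge> M" for i
    using stable[OF that] unfolding S_def
    by (intro equalityI) (simp_all add: monomials_subset_by_slices[OF Suc.prems(1)])
  then show ?case by blast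
qed

lemma homogeneous_part_decompose:
  assumes "C \<subseteq> monomials (Suc k)"
  shows "{m \<in> C. monom_degree m = n} =
    (\<Union>j\<le>n. (\<lambda>m. m + Poly_Mapping.single k j) ` {m \<in> slice k C j. monom_degree m = n - j})"
    (is "?L = ?R")
proof
  show "?L \<subseteq> ?R"
  proof
    fix m assume m: "m \<in> ?L"
    then obtain m' j where m': "m' \<in> monomials k" "m = m' + Poly_Mapping.single k j"
      using assms monomials_Suc_decompose by blast
    then have "monom_degree m' = n - j" "j \<le> n"
      using m by (auto simp: monom_degree_add)
    then show "m \<in> ?R"
      using m m' by (auto simp: slice_def)
  qed
  show "?R \<subseteq> ?L"
    by (auto simp: slice_def monom_degree_add)
qed

lemma finite_homogeneous_part:
  assumes "C \<subseteq> monomials k"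
  shows "finite {m \<in> C. monom_degree m = n}"
  using assms
proof (induction k arbitrary: C n)
  case 0
  then have "{m \<in> C. monom_degree m = n} \<subseteq> {0}" by (auto simp: monomials_0)
  then show ?case by (rule finite_subset) simp
next
  case (Suc k)
  then show ?case
    by (auto simp: homogeneous_part_decompose[OF Suc.prems] slice_subset intro!: Suc.IH)
qed

lemma card_homogeneous_part_Suc:
  assumes "C \<subseteq> monomials (Suc k)"
  shows "card {m \<in> C. monom_degree m = n} =
    (\<Sum>j\<le>n. card {m \<in> slice k C j. monom_degree m = n - j})"
proof -
  have fin: "finite {m \<in> slice k C j. monom_degree m = n'}" for j n'
    by (rule finite_homogeneous_part) (rule slice_subset)
  have "card {m \<in> C. monom_degree m = n} =
    (\<Sum>j\<le>n. card ((\<lambda>m. m + Poly_Mapping.single k j) ` {m \<in> slice k C j. monom_degree m = n - j}))"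
    unfolding homogeneous_part_decompose[OF assms]
    by (rule card_UN_disjoint) (use fin in \<open>auto simp: slice_def add_single_eq_iff\<close>)
  also have "\<dots> = (\<Sum>j\<le>n. card {m \<in> slice k C j. monom_degree m = n - j})"
    by (intro sum.cong card_image) (auto simp: inj_on_def)
  finally show ?thesis .
qed

text \<open>Induction on the number of variables. The slices decrease with the exponent of the last
  variable and hence stabilise, so the count is a finite sum of shifted counts for the early slices
  plus a partial sum for the stable one.\<close>

lemma eventually_poly_card_divisor_closed:
  assumes "C \<subseteq> monomials k" "divisor_closed C"
  shows "eventually_poly (\<lambda>n. of_nat (card {m \<in> C. monom_degree m = n}))"
  using assms
proof (induction k arbitrary: C)
  case 0
  have "eventually_poly (\<lambda>_. 0)"
    unfolding eventually_poly_def by (intro exI[of _ 0]) simp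
  moreover have "of_nat (card {m \<in> C. monom_degree m = n}) = (0 :: rat)" if "n \<ge> 1" for n
  proof -
    have "{m \<in> C. monom_degree m = n} = {}"
      using 0(1) that by (auto simp: monomials_0 monom_degree_def)
    then show ?thesis by (simp only: card.empty of_nat_0)
  qed
  ultimately show ?case by (rule eventually_poly_cong[rotated])
next
  case (Suc k)
  define c where "c j n = (of_nat (card {m \<in> slice k C j. monom_degree m = n}) :: rat)" for j n
  have c: "eventually_poly (c j)" for j
    unfolding c_def by (rule Suc.IH) (use Suc.prems in \<open>auto simp: slice_subset divisor_closed_slice\<close>)
  have "\<exists>N. \<forall>i\<ge>N. slice k C i = slice k C N"
    using Suc.prems(2) by (intro divisor_closed_chain_stabilises[where k = k] antimonoI)
      (simp_all only: slice_subset divisor_closed_slice slice_antimono)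
  then obtain N where stable: "\<And>i. i \<ge> N \<Longrightarrow> slice k C i = slice k C N" by blast
  have N: "c i = c N" if "i \<ge> N" for i
    unfolding c_def stable[OF that] ..
  have "of_nat (card {m \<in> C. monom_degree m = n}) = (\<Sum>j<N. c j (n - j)) + (\<Sum>i\<le>n - N. c N i)"
    if n: "n \<ge> N" for n
  proof -
    have "of_nat (card {m \<in> C. monom_degree m = n}) = (\<Sum>j\<le>n. c j (n - j))"
      by (simp add: card_homogeneous_part_Suc[OF Suc.prems(1)] c_def)
    also have "{..n} = {..<N} \<union> {N..n}"
      using n by auto
    also have "(\<Sum>j\<in>\<dots>. c j (n - j)) = (\<Sum>j<N. c j (n - j)) + (\<Sum>j\<in>{N..n}. c j (n - j))"
      by (intro sum.union_disjoint) auto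
    also have "(\<Sum>j\<in>{N..n}. c j (n - j)) = (\<Sum>j\<in>{N..n}. c N (n - j))"
      by (intro sum.cong refl fun_cong[OF N]) simp
    also have "\<dots> = (\<Sum>i\<le>n - N. c N i)"
      by (rule sum.reindex_bij_witness[of _ "\<lambda>i. n - i" "\<lambda>j. n - j"]) (use n in auto)
    finally show ?thesis .
  qed
  moreover have "eventually_poly (\<lambda>n. (\<Sum>j<N. c j (n - j)) + (\<Sum>i\<le>n - N. c N i))"
    by (rule eventually_poly_add[OF eventually_poly_sum[OF eventually_poly_shift[OF c]]
          eventually_poly_shift[OF eventually_poly_partial_sums[OF c]]])
  ultimately show ?case by (rule eventually_poly_cong)
qed

section \<open>Polynomials bounded by a linear function\<close>

lemma poly_pos_if_lead_coeff_pos: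
  fixes p :: "rat poly"
  assumes "lead_coeff p > 0"
  shows "\<exists>N. \<forall>n\<ge>N. poly p (of_nat n) > 0"
proof -
  \<comment> \<open>Passing to real coefficients makes the growth theorem for real polynomials
    applicable.\<close>
  define q where "q = map_poly real_of_rat p"
  have "degree q = degree p"
    unfolding q_def by (rule degree_map_poly) auto
  then have "lead_coeff q > 0"
    using assms unfolding q_def by (simp add: coeff_map_poly)
  then obtain x0 where x0: "\<And>x. x \<ge> x0 \<Longrightarrow> poly q x \<ge> lead_coeff q"
    using poly_pinfty_gt_lc by blast
  have "poly p (of_nat n) > 0" if "n \<ge> nat \<lceil>x0\<rceil>" for n
  proof -
    have "poly q (real n) > 0"
      using x0[of "real n"] that \<open>lead_coeff q > 0\<close> by linarith
    moreover have "poly q (of_rat x) = of_rat (poly p x)" for x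
      unfolding q_def by (induction p) (simp_all add: map_poly_pCons of_rat_add of_rat_mult)
    from this[of "of_nat n"] have "poly q (real n) = of_rat (poly p (of_nat n))" by simp
    ultimately show ?thesis by simp
  qed
  then show ?thesis by blast
qed

lemma degree_le_1_if_linear_bound:
  fixes p :: "rat poly"
  assumes "\<And>n. n \<ge> N \<Longrightarrow> \<bar>poly p (of_nat n)\<bar> \<le> A * of_nat n + B"
  shows "degree p \<le> 1"
proof (rule ccontr)
  assume "\<not> degree p \<le> 1"
  then have deg: "degree p > 1" by simp
  \<comment> \<open>Subtracting a linear bound leaves a leading term of degree above 1 unchanged, so
    the difference would eventually be positive. This is applied to \<open>p\<close> or
    \<open>- p\<close>, according to the sign of the leading coefficient.\<close>
  have *: False if "degree q = degree p" "lead_coeff q > 0"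
    "\<And>n. n \<ge> N \<Longrightarrow> poly q (of_nat n) \<le> A * of_nat n + B" for q
  proof -
    have "degree [:B, A:] < degree q"
      using deg that(1) by (simp split: if_splits)
    then have "lead_coeff (q - [:B, A:]) = lead_coeff q"
      by (metis (no_types, lifting) add_uminus_conv_diff degree_minus lead_coeff_add_le add.commute)
    with that(2) have "lead_coeff (q - [:B, A:]) > 0" by simp
    then obtain M where "\<And>n. n \<ge> M \<Longrightarrow> poly (q - [:B, A:]) (of_nat n) > 0"
      using poly_pos_if_lead_coeff_pos by blast
    from this[of "max M N"] that(3)[of "max M N"] show False
      by (simp add: algebra_simps)
  qed
  have "lead_coeff p \<noteq> 0" using deg by auto
  then consider "lead_coeff p > 0" | "lead_coeff (- p) > 0"
    by force
  then show False
  proof cases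
    case 1
    then show False using *[of p] assms abs_le_D1 by blast
  next
    case 2
    moreover have "poly (- p) (of_nat n) \<le> A * of_nat n + B" if "n \<ge> N" for n
      using assms[OF that] by simp
    ultimately show False using *[of "- p"] by simp
  qed
qed

lemma rat_poly_eqI:
  fixes p q :: "rat poly"
  assumes "\<forall>\<^sub>F n in sequentially. poly p (of_nat n) = poly q (of_nat n)"
  shows "p = q"
proof (rule ccontr)
  assume "p \<noteq> q"
  then have "p - q \<noteq> 0" by simp
  then have "finite {x. poly (p - q) x = 0}" by (rule poly_roots_finite)
  moreover obtain N where N: "\<And>n. n \<ge> N \<Longrightarrow> poly p (of_nat n) = poly q (of_nat n)"
    using assms unfolding eventually_sequentially by blast
  then have "of_nat ` {N..} \<subseteq> {x. poly (p - q) x = 0}" by auto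
  ultimately have "finite (of_nat ` {N..} :: rat set)" by (rule rev_finite_subset)
  then have "finite {N..}" by (rule finite_imageD) (simp add: inj_on_def)
  then show False by (simp add: infinite_Ici)
qed

text \<open>An error of order O(n) cannot affect the quadratic term. The Hilbert polynomial thus has
  degree 2 and leading coefficient \<open>D / 2\<close>, and the factor 2! restores
  \<open>D\<close>; positivity of \<open>D\<close> keeps the degree from dropping.\<close>

lemma ideal_degree_eqI:
  assumes "eventually_poly (\<lambda>n. of_nat (hilbert_function d I n))" "D > 0"
    "\<And>n. n \<ge> N \<Longrightarrow> \<bar>of_nat (hilbert_function d I n) - D / 2 * of_nat n ^ 2\<bar> \<le> A * of_nat n + B"
  shows "ideal_degree d I = D"
proof -
  obtain P where P: "\<forall>\<^sub>F n in sequentially. rat_of_nat (hilbert_function d I n) = poly P (of_nat n)"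
    using assms(1) unfolding eventually_poly_def by blast
  have hp: "hilbert_polynomial d I = P"
    unfolding hilbert_polynomial_def
  proof (rule the_equality)
    show "\<forall>\<^sub>F n in sequentially. of_nat (hilbert_function d I n) = poly P (of_nat n)" by (rule P)
    fix Q assume "\<forall>\<^sub>F n in sequentially. rat_of_nat (hilbert_function d I n) = poly Q (of_nat n)"
    with P have "\<forall>\<^sub>F n in sequentially. poly Q (of_nat n) = poly P (of_nat n :: rat)"
      by eventually_elim simp
    then show "Q = P" by (rule rat_poly_eqI)
  qed
  define M where "M = Polynomial.monom (D / 2) 2"
  have deg_M: "degree M = 2"
    using assms(2) by (simp add: M_def degree_monom_eq)
  obtain N' where N': "\<And>n. n \<ge> N' \<Longrightarrow> of_nat (hilbert_function d I n) = poly P (of_nat n)"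
    using P unfolding eventually_sequentially by blast
  have "degree (P - M) \<le> 1"
  proof (rule degree_le_1_if_linear_bound)
    fix n assume "n \<ge> max N N'"
    then show "\<bar>poly (P - M) (of_nat n)\<bar> \<le> A * of_nat n + B"
      using assms(3)[of n] N'[of n] by (simp add: M_def poly_monom)
  qed
  then have less: "degree (P - M) < degree M" using deg_M by simp
  have PM: "P = (P - M) + M" by simp
  have "degree P = 2" using degree_add_eq_right[OF less] deg_M by simp
  moreover have "lead_coeff P = D / 2"
    using lead_coeff_add_le[OF less] by (simp add: M_def degree_monom_eq assms(2)[THEN less_imp_neq[symmetric]])
  ultimately show ?thesis
    unfolding ideal_degree_def hp Let_def by (auto simp: fact_numeral)
qed

section \<open>The polynomials with values the inverse Gaussian moments\<close>

text \<open>Bessel polynomials, shifted by one index: the moment of order i is \<open>\<mu> ^ i\<close> times the value of the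
  i-th of them at \<open>\<mu> / \<lambda>\<close>.\<close>

fun bessel :: "nat \<Rightarrow> complex poly" where
  "bessel 0 = 1"
| "bessel (Suc 0) = 1"
| "bessel (Suc (Suc i)) = Polynomial.smult (of_nat (2 * i + 1)) (pCons 0 (bessel (Suc i))) + bessel i"

lemma ig_moment_eq: "ig_moment \<mu> l i = \<mu> ^ i * poly (bessel i) (\<mu> / l)"
  by (induction i rule: bessel.induct)
    (simp_all add: algebra_simps power2_eq_square add_divide_distrib)

lemma degree_bessel_Suc: "degree (bessel (Suc i)) = i"
proof -
  \<comment> \<open>The recurrence reaches two steps back, so two consecutive degrees are carried
    along. Its factor 2 i + 1 is never zero, hence the shifted summand dominates.\<close>
  have "degree (bessel (Suc i)) = i \<and> degree (bessel (Suc (Suc i))) = Suc i" for i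
  proof (induction i)
    case (Suc i)
    have ne: "(of_nat (2 * Suc i + 1) :: complex) \<noteq> 0"
      unfolding of_nat_eq_0_iff by simp
    have "bessel (Suc (Suc i)) \<noteq> 0" using Suc by auto
    then have "degree (Polynomial.smult (of_nat (2 * Suc i + 1)) (pCons 0 (bessel (Suc (Suc i))))) = Suc (Suc i)"
      using Suc ne by (simp del: bessel.simps of_nat_add of_nat_Suc)
    then show ?case
      using Suc unfolding bessel.simps(3)[of "Suc i"]
      by (simp del: bessel.simps add: degree_add_eq_left)
  qed (simp add: one_pCons)
  then show ?thesis by blast
qed

lemma degree_bessel: "degree (bessel i) = i - 1"
  by (cases i) (simp_all add: degree_bessel_Suc)

lemma bessel_nonzero [simp]: "bessel i \<noteq> 0"
proof (cases "i \<le> 1")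
  case True
  then show ?thesis by (cases i) auto
next
  case False
  then show ?thesis using degree_bessel[of i] by auto
qed

text \<open>The recurrence is a step of Euclid's algorithm: modulo \<open>bessel (Suc i)\<close>,
  the next polynomial is \<open>bessel i\<close>.\<close>

lemma coprime_bessel: "coprime (bessel i) (bessel (Suc i))"
proof (induction i)
  case (Suc i)
  have "bessel (Suc (Suc i)) = [:0, of_nat (2 * i + 1):] * bessel (Suc i) + bessel i"
    by simp
  then have "gcd (bessel (Suc i)) (bessel (Suc (Suc i))) = gcd (bessel (Suc i)) (bessel i)"
    by (simp only: gcd_add_mult)
  then show ?case
    using Suc by (simp only: coprime_iff_gcd_eq_1 gcd.commute)
qed simp

section \<open>Standard monomials\<close>

text \<open>The indices at which a family indexed by a linear order jumps out of the span of its
  predecessors; for the monomials of one degree these are the standard monomials.\<close>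

definition standard_indices :: "('b set \<Rightarrow> 'b set) \<Rightarrow> ('c::linorder \<Rightarrow> 'b) \<Rightarrow> 'c set \<Rightarrow> 'c set" where
  "standard_indices sp f A = {i \<in> A. f i \<notin> sp (f ` {j \<in> A. j < i})}"

lemma standard_indices_subset: "standard_indices sp f A \<subseteq> A"
  by (auto simp: standard_indices_def)

text \<open>Indices are added in increasing order: a new maximum does not change which smaller ones
  are standard, and it enlarges the basis exactly when its vector lies outside the current
  span.\<close>

lemma (in vector_space) standard_indices_basis:
  assumes "finite A"
  shows "inj_on f (standard_indices span f A) \<and> independent (f ` standard_indices span f A) \<and>
    span (f ` standard_indices span f A) = span (f ` A)"
  using assms
proof (induction A rule: finite_linorder_max_induct)
  case empty
  then show ?case by (simp add: standard_indices_def independent_empty)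
next
  case (insert b A)
  have below_b: "{j \<in> insert b A. j < b} = A"
    using insert.hyps(2) by auto
  have below: "{j \<in> insert b A. j < i} = {j \<in> A. j < i}" if "i \<in> A" for i
    using insert.hyps(2) that by force
  have S: "standard_indices span f (insert b A) =
      (if f b \<in> span (f ` A) then standard_indices span f A else insert b (standard_indices span f A))"
    unfolding standard_indices_def using below below_b by auto
  show ?case
  proof (cases "f b \<in> span (f ` A)")
    case True
    then show ?thesis using insert.IH by (simp add: S span_redundant)
  next
    case False
    then have notin: "f b \<notin> span (f ` standard_indices span f A)" using insert.IH by simp
    then have "f b \<notin> f ` standard_indices span f A" by (meson span_base)
    moreover have "span (insert (f b) (f ` standard_indices span f A)) = span (insert (f b) (f ` A))"
      using insert.IH by (simp add: span_insert)
    ultimately show ?thesis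
      using False insert.IH notin by (auto simp: S inj_on_insert independent_insert)
  qed
qed

lemma (in vector_space) card_le_if_no_linear_relation:
  assumes "finite I" "finite T" "g ` I \<subseteq> span T"
    and no_relation: "\<And>c. (\<Sum>i\<in>I. scale (c i) (g i)) = 0 \<Longrightarrow> \<forall>i\<in>I. c i = 0"
  shows "card I \<le> card T"
proof -
  have inj: "inj_on g I"
  proof (rule inj_onI, rule ccontr)
    fix i j assume ij: "i \<in> I" "j \<in> I" "g i = g j" "i \<noteq> j"
    \<comment> \<open>A repeated value would yield the relation with coefficients 1 and -1, so
      absence of relations for the family also forces injectivity.\<close>
    define c where "c k = (if k = i then 1 else if k = j then - 1 else 0 :: 'a)" for k
    have "(\<Sum>k\<in>I. scale (c k) (g k)) = (\<Sum>k\<in>{i, j}. scale (c k) (g k))"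
      using assms(1) ij by (intro sum.mono_neutral_right) (auto simp: c_def)
    also have "\<dots> = 0" using ij by (simp add: c_def)
    finally show False using no_relation[of c] ij by (auto simp: c_def)
  qed
  have "independent (g ` I)"
  proof (rule independent_if_scalars_zero)
    fix f x assume "(\<Sum>x\<in>g ` I. scale (f x) x) = 0" "x \<in> g ` I"
    then show "f x = 0"
      using no_relation[of "f \<circ> g"] by (auto simp: sum.reindex[OF inj])
  qed (use assms(1) in simp)
  then have "card (g ` I) \<le> card T"
    using independent_span_bound[OF assms(2)] assms(3) by blast
  then show ?thesis by (simp add: card_image[OF inj])
qed

text \<open>The outer variable stands for \<open>\<mu>\<close> and the inner one for \<open>\<mu> / \<lambda>\<close>.\<close>

definition bscale :: "complex \<Rightarrow> complex poly poly \<Rightarrow> complex poly poly" where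
  "bscale c p = Polynomial.smult [:c:] p"

interpretation bvs: vector_space bscale
  by unfold_locales
    (simp_all add: bscale_def smult_add_right mult.commute one_pCons[symmetric] flip: smult_add_left)

lemma bscale_mult_left: "bscale c p * q = bscale c (p * q)"
  and bscale_mult_right: "p * bscale c q = bscale c (p * q)"
  by (simp_all add: bscale_def)

lemma bscale_monom: "bscale c (Polynomial.monom p k) = Polynomial.monom (Polynomial.smult c p) k"
  by (simp add: bscale_def smult_monom)

text \<open>The monomial \<open>m\<close> with \<open>\<mu> ^ i * bessel i\<close> substituted for
  the i-th variable; the powers of \<open>\<mu>\<close> are gathered in the outer exponent, called
  the weight below.\<close>

definition bmon :: "nat \<Rightarrow> (nat \<Rightarrow>\<^sub>0 nat) \<Rightarrow> complex poly poly" where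
  "bmon d m = Polynomial.monom (\<Prod>i\<le>d. bessel i ^ Poly_Mapping.lookup m i) (\<Sum>i\<le>d. i * Poly_Mapping.lookup m i)"

lemma bmon_0 [simp]: "bmon d 0 = 1"
  by (simp add: bmon_def)

lemma bmon_add: "bmon d (a + b) = bmon d a * bmon d b"
  by (simp add: bmon_def lookup_add power_add prod.distrib distrib_left sum.distrib mult_monom)

definition hom_monomials :: "nat \<Rightarrow> nat \<Rightarrow> (nat \<Rightarrow>\<^sub>0 nat) set" where
  "hom_monomials d n = {m \<in> monomials (Suc d). monom_degree m = n}"

lemma finite_hom_monomials [simp]: "finite (hom_monomials d n)"
  unfolding hom_monomials_def by (rule finite_homogeneous_part) (rule order_refl)

lemma add_hom_monomials:
  "a \<in> hom_monomials d n \<Longrightarrow> b \<in> hom_monomials d k \<Longrightarrow> a + b \<in> hom_monomials d (n + k)"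
  by (simp add: hom_monomials_def add_in_monomials_iff monom_degree_add)

lemma mult_in_span_bmon:
  assumes "x \<in> bvs.span (bmon d ` A)" "\<And>a. a \<in> A \<Longrightarrow> a + m \<in> B"
  shows "x * bmon d m \<in> bvs.span (bmon d ` B)"
  using assms(1)
proof (induction rule: bvs.span_induct_alt)
  case base
  then show ?case by (simp add: bvs.span_zero)
next
  case (step c x y)
  then obtain a where "a \<in> A" "x = bmon d a" by blast
  then have "x * bmon d m \<in> bvs.span (bmon d ` B)"
    using assms(2) by (metis bmon_add bvs.span_base imageI)
  with step(2) show ?case
    by (simp add: distrib_right bscale_mult_left bvs.span_add bvs.span_scale)
qed

definition standard_monomials :: "nat \<Rightarrow> nat \<Rightarrow> (nat \<Rightarrow>\<^sub>0 nat) set" where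
  "standard_monomials d n = standard_indices bvs.span (bmon d) (hom_monomials d n)"

text \<open>If \<open>a\<close> were dependent on smaller monomials, multiplication by
  \<open>b\<close> would make \<open>a + b\<close> dependent on smaller ones of its degree, because
  the order on monomials is compatible with addition.\<close>

lemma standard_monomial_divisor:
  assumes "a + b \<in> standard_monomials d (monom_degree (a + b))"
  shows "a \<in> standard_monomials d (monom_degree a)"
proof (rule ccontr)
  have ab: "a \<in> hom_monomials d (monom_degree a)" "b \<in> hom_monomials d (monom_degree b)"
    using assms standard_indices_subset
    by (auto simp: standard_monomials_def hom_monomials_def standard_indices_def add_in_monomials_iff)
  assume "a \<notin> standard_monomials d (monom_degree a)"
  then have "bmon d a \<in> bvs.span (bmon d ` {j \<in> hom_monomials d (monom_degree a). j < a})"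
    using ab by (simp add: standard_monomials_def standard_indices_def)
  then have "bmon d a * bmon d b \<in> bvs.span (bmon d ` {j \<in> hom_monomials d (monom_degree (a + b)). j < a + b})"
    by (rule mult_in_span_bmon) (use ab in \<open>auto simp: monom_degree_add add_hom_monomials\<close>)
  then show False
    using assms by (simp add: bmon_add standard_monomials_def standard_indices_def)
qed

lemma eventually_poly_card_standard_monomials:
  "eventually_poly (\<lambda>n. of_nat (card (standard_monomials d n)))"
proof -
  \<comment> \<open>Gathering the standard monomials of all degrees gives a single divisor-closed
    set, whose homogeneous parts are the sets to be counted.\<close>
  define C where "C = {m. m \<in> standard_monomials d (monom_degree m)}"
  have "C \<subseteq> monomials (Suc d)"
    by (auto simp: C_def standard_monomials_def standard_indices_def hom_monomials_def)
  moreover have "divisor_closed C"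
    unfolding divisor_closed_def C_def using standard_monomial_divisor by blast
  ultimately have "eventually_poly (\<lambda>n. of_nat (card {m \<in> C. monom_degree m = n}))"
    by (rule eventually_poly_card_divisor_closed)
  moreover have "{m \<in> C. monom_degree m = n} = standard_monomials d n" for n
    by (auto simp: C_def standard_monomials_def standard_indices_def hom_monomials_def)
  ultimately show ?thesis by simp
qed

section \<open>Evaluation of polynomials at the moments\<close>

lemma mpolys_eq: "mpolys d = {p. Poly_Mapping.keys p \<subseteq> monomials (Suc d)}"
  by (auto simp: mpolys_def monomials_def lessThan_Suc_atMost)

lemma forms_eq: "forms d n = {p. Poly_Mapping.keys p \<subseteq> hom_monomials d n}"
  by (auto simp: forms_def mpolys_eq hom_monomials_def)

lemma poly_mapping_single_induct [case_names zero add]: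
  assumes "P 0" "\<And>p a b. P p \<Longrightarrow> P (p + Poly_Mapping.single a b)"
  shows "P (p :: 'a \<Rightarrow>\<^sub>0 'b::comm_monoid_add)"
proof (induction p rule: update_induct)
  case (update f a b)
  have "Poly_Mapping.update a b f = f + Poly_Mapping.single a b"
    using update(1) by (intro poly_mapping_eqI) (auto simp: lookup_update lookup_add lookup_single in_keys_iff)
  then show ?case using assms(2)[OF update(3)] by simp
qed (rule assms(1))

section \<open>Evaluation at complex coordinate vectors\<close>

definition eval_monom :: "(nat \<Rightarrow> complex) \<Rightarrow> (nat \<Rightarrow>\<^sub>0 nat) \<Rightarrow> complex" where
  "eval_monom x m = (\<Prod>i\<in>Poly_Mapping.keys m. x i ^ Poly_Mapping.lookup m i)"

lemma eval_monom_superset: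
  assumes "finite A" "Poly_Mapping.keys m \<subseteq> A"
  shows "eval_monom x m = (\<Prod>i\<in>A. x i ^ Poly_Mapping.lookup m i)"
  unfolding eval_monom_def using assms
  by (intro prod.mono_neutral_left) (auto simp: in_keys_iff)

lemma eval_monom_add: "eval_monom x (a + b) = eval_monom x a * eval_monom x b"
proof -
  let ?A = "Poly_Mapping.keys a \<union> Poly_Mapping.keys b"
  have "Poly_Mapping.keys (a + b) \<subseteq> ?A"
    by (rule Poly_Mapping.keys_add)
  then show ?thesis
    by (simp add: eval_monom_superset[of ?A] lookup_add power_add prod.distrib)
qed

lemma eval_mpoly_superset:
  assumes "finite A" "Poly_Mapping.keys p \<subseteq> A"
  shows "eval_mpoly x p = (\<Sum>m\<in>A. Poly_Mapping.lookup p m * eval_monom x m)"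
  unfolding eval_mpoly_def eval_monom_def[symmetric] using assms
  by (intro sum.mono_neutral_left) (auto simp: in_keys_iff)

lemma eval_mpoly_zero [simp]: "eval_mpoly x 0 = 0"
  by (simp add: eval_mpoly_def)

lemma eval_mpoly_add: "eval_mpoly x (p + q) = eval_mpoly x p + eval_mpoly x q"
proof -
  let ?A = "Poly_Mapping.keys p \<union> Poly_Mapping.keys q"
  have "Poly_Mapping.keys (p + q) \<subseteq> ?A"
    by (rule Poly_Mapping.keys_add)
  then show ?thesis
    by (simp add: eval_mpoly_superset[of ?A] lookup_add distrib_right sum.distrib)
qed

lemma eval_mpoly_single: "eval_mpoly x (Poly_Mapping.single m c) = c * eval_monom x m"
  by (subst eval_mpoly_superset[of "{m}"]) auto

lemma eval_mpoly_mult: "eval_mpoly x (p * q) = eval_mpoly x p * eval_mpoly x q"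
proof (induction p rule: poly_mapping_single_induct)
  case (add p a b)
  have "eval_mpoly x (Poly_Mapping.single a b * q) = b * eval_monom x a * eval_mpoly x q"
    by (induction q rule: poly_mapping_single_induct)
      (simp_all add: distrib_left eval_mpoly_add mult_single eval_mpoly_single eval_monom_add)
  with add show ?case
    by (simp add: distrib_right eval_mpoly_add eval_mpoly_single)
qed simp

lemma eval_mpoly_uminus: "eval_mpoly x (- p) = - eval_mpoly x p"
  using eval_mpoly_add[of x p "- p"] by (simp add: eq_neg_iff_add_eq_0 add.commute)

lemma eval_mpoly_form_scaled:
  assumes "p \<in> forms d n"
  shows "eval_mpoly (\<lambda>i. c * x i) p = c ^ n * eval_mpoly x p"
proof -
  have "eval_monom (\<lambda>i. c * x i) m = c ^ n * eval_monom x m" if "m \<in> Poly_Mapping.keys p" for m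
  proof -
    have "monom_degree m = n" using that assms by (simp add: forms_def)
    then show ?thesis
      by (auto simp: eval_monom_def power_mult_distrib prod.distrib monom_degree_def power_sum)
  qed
  then show ?thesis
    by (simp add: eval_mpoly_superset[of "Poly_Mapping.keys p"] sum_distrib_left algebra_simps)
qed

text \<open>Substitution of the moments, as polynomials in \<open>\<mu>\<close> and
  \<open>\<mu> / \<lambda>\<close>, for the variables. On forms its kernel turns out to be the
  vanishing ideal.\<close>

definition beval :: "nat \<Rightarrow> mpoly \<Rightarrow> complex poly poly" where
  "beval d p = (\<Sum>m\<in>Poly_Mapping.keys p. bscale (Poly_Mapping.lookup p m) (bmon d m))"

lemma beval_superset:
  assumes "finite A" "Poly_Mapping.keys p \<subseteq> A"
  shows "beval d p = (\<Sum>m\<in>A. bscale (Poly_Mapping.lookup p m) (bmon d m))"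
  unfolding beval_def using assms
  by (intro sum.mono_neutral_left) (auto simp: in_keys_iff)

lemma beval_add: "beval d (p + q) = beval d p + beval d q"
proof -
  let ?A = "Poly_Mapping.keys p \<union> Poly_Mapping.keys q"
  have "Poly_Mapping.keys (p + q) \<subseteq> ?A"
    by (rule Poly_Mapping.keys_add)
  then show ?thesis
    by (simp add: beval_superset[of ?A] lookup_add bvs.scale_left_distrib sum.distrib)
qed

lemma beval_single: "beval d (Poly_Mapping.single m c) = bscale c (bmon d m)"
  by (subst beval_superset[of "{m}"]) auto

lemma beval_zero [simp]: "beval d 0 = 0"
  by (simp add: beval_def)

lemma beval_diff: "beval d (p - q) = beval d p - beval d q"
  using beval_add[of d "p - q" q] by simp

lemma beval_scale: "beval d (Poly_Mapping.single 0 c * p) = bscale c (beval d p)"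
  by (induction p rule: poly_mapping_single_induct)
    (simp_all add: distrib_left beval_add mult_single beval_single bvs.scale_right_distrib)

lemma keys_scale_subset:
  "Poly_Mapping.keys (Poly_Mapping.single 0 (c::'a::semiring_0) * p) \<subseteq> Poly_Mapping.keys (p :: 'b::monoid_add \<Rightarrow>\<^sub>0 'a)"
  using Poly_Mapping.keys_mult[of "Poly_Mapping.single 0 c" p] by (auto split: if_splits)

text \<open>Translates spans in the space of bivariate polynomials into polynomials with prescribed
  support, whose cosets are needed later.\<close>

lemma span_bmon_eq: "bvs.span (bmon d ` A) = beval d ` {p. Poly_Mapping.keys p \<subseteq> A}"
proof (rule equalityI)
  show "bvs.span (bmon d ` A) \<subseteq> beval d ` {p. Poly_Mapping.keys p \<subseteq> A}"
  proof (rule bvs.span_minimal)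
    show "bmon d ` A \<subseteq> beval d ` {p. Poly_Mapping.keys p \<subseteq> A}"
    proof
      fix x assume "x \<in> bmon d ` A"
      then obtain m where "m \<in> A" "x = bmon d m" by blast
      then show "x \<in> beval d ` {p. Poly_Mapping.keys p \<subseteq> A}"
        by (intro image_eqI[of _ _ "Poly_Mapping.single m 1"]) (auto simp: beval_single)
    qed
    show "bvs.subspace (beval d ` {p. Poly_Mapping.keys p \<subseteq> A})"
    proof (rule bvs.subspaceI)
      show "0 \<in> beval d ` {p. Poly_Mapping.keys p \<subseteq> A}"
        by (intro image_eqI[of _ _ 0]) auto
    next
      fix x y assume "x \<in> beval d ` {p. Poly_Mapping.keys p \<subseteq> A}" "y \<in> beval d ` {p. Poly_Mapping.keys p \<subseteq> A}"
      then obtain p q where "Poly_Mapping.keys p \<subseteq> A" "x = beval d p" "Poly_Mapping.keys q \<subseteq> A" "y = beval d q"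
        by blast
      then show "x + y \<in> beval d ` {p. Poly_Mapping.keys p \<subseteq> A}"
        using Poly_Mapping.keys_add[of p q] by (intro image_eqI[of _ _ "p + q"]) (auto simp: beval_add)
    next
      fix c x assume "x \<in> beval d ` {p. Poly_Mapping.keys p \<subseteq> A}"
      then obtain p where "Poly_Mapping.keys p \<subseteq> A" "x = beval d p" by blast
      then show "bscale c x \<in> beval d ` {p. Poly_Mapping.keys p \<subseteq> A}"
        using keys_scale_subset[of c p]
        by (intro image_eqI[of _ _ "Poly_Mapping.single 0 c * p"]) (auto simp: beval_scale)
    qed
  qed
  show "beval d ` {p. Poly_Mapping.keys p \<subseteq> A} \<subseteq> bvs.span (bmon d ` A)"
    unfolding beval_def by (auto intro!: bvs.span_sum bvs.span_scale intro: bvs.span_base)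
qed

section \<open>Comparison of the two evaluations at moment vectors\<close>

abbreviation ig_point :: "nat \<Rightarrow> complex \<Rightarrow> complex \<Rightarrow> nat \<Rightarrow> complex" where
  "ig_point d \<mu> l \<equiv> (\<lambda>i. if i \<le> d then ig_moment \<mu> l i else 0)"

lemma eval_mpoly_ig_point:
  assumes "p \<in> mpolys d"
  shows "eval_mpoly (ig_point d \<mu> l) p = poly (poly (beval d p) [:\<mu>:]) (\<mu> / l)"
proof -
  have "eval_monom (ig_point d \<mu> l) m = poly (poly (bmon d m) [:\<mu>:]) (\<mu> / l)"
    if "m \<in> Poly_Mapping.keys p" for m
  proof -
    have "Poly_Mapping.keys m \<subseteq> {..d}" using that assms by (simp add: mpolys_def)
    then have "eval_monom (ig_point d \<mu> l) m = (\<Prod>i\<le>d. ig_moment \<mu> l i ^ Poly_Mapping.lookup m i)"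
      by (simp add: eval_monom_superset[of "{..d}"])
    also have "\<dots> = (\<Prod>i\<le>d. \<mu> ^ (i * Poly_Mapping.lookup m i)) * (\<Prod>i\<le>d. poly (bessel i) (\<mu> / l) ^ Poly_Mapping.lookup m i)"
      by (simp add: ig_moment_eq power_mult_distrib prod.distrib power_mult)
    also have "\<dots> = poly (poly (bmon d m) [:\<mu>:]) (\<mu> / l)"
      by (simp add: bmon_def poly_monom poly_prod poly_power power_sum mult.commute)
    finally show ?thesis .
  qed
  then show ?thesis
    by (simp add: eval_mpoly_superset[of "Poly_Mapping.keys p"] beval_def poly_sum bscale_def)
qed

text \<open>For a fixed nonzero \<open>\<mu>\<close> the quotient \<open>\<mu> / l\<close> runs
  through all nonzero numbers, so the inner polynomial has infinitely many roots; then the outer one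
  has infinitely many roots, too.\<close>

lemma poly_poly_eq_0I:
  fixes Q :: "complex poly poly"
  assumes "\<And>\<mu> l. l \<noteq> 0 \<Longrightarrow> poly (poly Q [:\<mu>:]) (\<mu> / l) = 0"
  shows "Q = 0"
proof (rule ccontr)
  assume "Q \<noteq> 0"
  have cofinite: "infinite (- {0 :: complex})"
    by (simp add: Compl_eq_Diff_UNIV infinite_UNIV_char_0)
  have "poly Q [:\<mu>:] = 0" if "\<mu> \<noteq> 0" for \<mu>
  proof (rule ccontr)
    assume "poly Q [:\<mu>:] \<noteq> 0"
    then have "finite {y. poly (poly Q [:\<mu>:]) y = 0}" by (rule poly_roots_finite)
    moreover have "- {0} \<subseteq> {y. poly (poly Q [:\<mu>:]) y = 0}"
      \<comment> \<open>The choice \<open>l = \<mu> / y\<close> is nonzero and gives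
        \<open>\<mu> / l = y\<close>.\<close>
      using assms[of "\<mu> / y" \<mu> for y] that by auto
    ultimately show False using cofinite finite_subset by blast
  qed
  then have "(\<lambda>\<mu>. [:\<mu>:]) ` (- {0}) \<subseteq> {x. poly Q x = 0}" by auto
  then have "finite ((\<lambda>\<mu>::complex. [:\<mu>:]) ` (- {0}))"
    using poly_roots_finite[OF \<open>Q \<noteq> 0\<close>] finite_subset by blast
  then show False
    using cofinite by (auto dest!: finite_imageD simp: inj_on_def)
qed

lemma beval_eq_0_iff:
  assumes "p \<in> mpolys d"
  shows "beval d p = 0 \<longleftrightarrow> (\<forall>\<mu> l. l \<noteq> 0 \<longrightarrow> eval_mpoly (ig_point d \<mu> l) p = 0)"
  using poly_poly_eq_0I[of "beval d p"] by (auto simp: eval_mpoly_ig_point[OF assms])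

section \<open>The Hilbert function of the moment variety\<close>

lemma mpoly_ring_simps [simp]:
  "carrier (mpoly_ring d) = mpolys d"
  "p \<otimes>\<^bsub>mpoly_ring d\<^esub> q = p * q"
  "\<one>\<^bsub>mpoly_ring d\<^esub> = 1"
  "\<zero>\<^bsub>mpoly_ring d\<^esub> = 0"
  "p \<oplus>\<^bsub>mpoly_ring d\<^esub> q = p + q"
  by (simp_all add: mpoly_ring_def)

lemma ring_mpoly_ring: "ring (mpoly_ring d)"
  using cring_mpoly_ring by (rule cring.axioms)

lemma mpolys_closed:
  "0 \<in> mpolys d" "1 \<in> mpolys d"
  "p \<in> mpolys d \<Longrightarrow> q \<in> mpolys d \<Longrightarrow> p + q \<in> mpolys d"
  "p \<in> mpolys d \<Longrightarrow> q \<in> mpolys d \<Longrightarrow> p * q \<in> mpolys d"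
  "p \<in> mpolys d \<Longrightarrow> - p \<in> mpolys d"
proof -
  interpret R: ring "mpoly_ring d" by (rule ring_mpoly_ring)
  show "0 \<in> mpolys d" "1 \<in> mpolys d"
    using R.zero_closed R.one_closed by (simp_all only: mpoly_ring_simps)
  show "p + q \<in> mpolys d" "p * q \<in> mpolys d" if "p \<in> mpolys d" "q \<in> mpolys d"
    using R.a_closed[of p q] R.m_closed[of p q] that by (simp_all only: mpoly_ring_simps)
  show "- p \<in> mpolys d" if "p \<in> mpolys d"
    using that by (simp add: mpolys_def)
qed

lemma a_inv_mpoly_ring:
  assumes "p \<in> mpolys d"
  shows "\<ominus>\<^bsub>mpoly_ring d\<^esub> p = - p"
  using abelian_group.minus_equality[of "mpoly_ring d" "- p" p] ring.is_abelian_group[OF ring_mpoly_ring]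
    assms mpolys_closed(5)[OF assms] by simp

lemma a_minus_mpoly_ring:
  assumes "q \<in> mpolys d"
  shows "p \<ominus>\<^bsub>mpoly_ring d\<^esub> q = p - q"
  using assms by (simp add: a_minus_def a_inv_mpoly_ring)

lemma constants_subset: "constants \<subseteq> mpolys d"
  by (auto simp: constants_def mpolys_eq split: if_splits)

lemma subfield_constants: "subfield constants (mpoly_ring d)"
proof -
  interpret R: cring "mpoly_ring d" by (rule cring_mpoly_ring)
  have sub: "subring constants (mpoly_ring d)"
  proof (rule R.subringI)
    show "constants \<subseteq> carrier (mpoly_ring d)" using constants_subset by simp
    show "\<one>\<^bsub>mpoly_ring d\<^esub> \<in> constants"
      unfolding constants_def by (auto intro: image_eqI[of _ _ 1])
  next
    fix h assume h: "h \<in> constants"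
    then show "\<ominus>\<^bsub>mpoly_ring d\<^esub> h \<in> constants"
      using constants_subset[of d] by (subst a_inv_mpoly_ring) (auto simp: constants_def simp flip: single_uminus)
  next
    fix h k assume "h \<in> constants" "k \<in> constants"
    then show "h \<otimes>\<^bsub>mpoly_ring d\<^esub> k \<in> constants" "h \<oplus>\<^bsub>mpoly_ring d\<^esub> k \<in> constants"
      by (auto simp: constants_def mult_single simp flip: single_add)
  qed
  show ?thesis
  proof (rule R.subfieldI)
    show "subcring constants (mpoly_ring d)"
      using R.subcringI'[OF sub] .
    show "Units (mpoly_ring d\<lparr>carrier := constants\<rparr>) = constants - {\<zero>\<^bsub>mpoly_ring d\<^esub>}"
    proof (intro equalityI subsetI)
      fix u assume "u \<in> Units (mpoly_ring d\<lparr>carrier := constants\<rparr>)"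
      then obtain v where "u \<in> constants" "v * u = 1"
        unfolding Units_def by auto
      then show "u \<in> constants - {\<zero>\<^bsub>mpoly_ring d\<^esub>}" by auto
    next
      fix u assume "u \<in> constants - {\<zero>\<^bsub>mpoly_ring d\<^esub>}"
      then obtain c where "u = Poly_Mapping.single 0 c" "u \<noteq> 0"
        by (auto simp: constants_def)
      then have c: "u = Poly_Mapping.single 0 c" "c \<noteq> 0" by auto
      then have "u * Poly_Mapping.single 0 (inverse c) = 1" "Poly_Mapping.single 0 (inverse c) * u = 1"
        by (simp_all add: mult_single)
      then show "u \<in> Units (mpoly_ring d\<lparr>carrier := constants\<rparr>)"
        using c unfolding Units_def constants_def by auto
    qed
  qed
qed

section \<open>The vanishing ideal and the kernel of \<open>beval\<close>\<close>

abbreviation ig_ideal :: "nat \<Rightarrow> mpoly set" where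
  "ig_ideal d \<equiv> vanishing_ideal d (ig_moment_variety d)"

lemma forms_subset_mpolys: "forms d n \<subseteq> mpolys d"
  by (auto simp: forms_def)

lemma ideal_ig_ideal: "ideal (ig_ideal d) (mpoly_ring d)"
  unfolding vanishing_ideal_def
  by (rule ring.genideal_ideal[OF ring_mpoly_ring]) (use forms_subset_mpolys in auto)

lemma ig_moment_points_subset_variety:
  "ig_moment_point d \<mu> l \<in> ig_moment_variety d" if "l \<noteq> 0"
  using that unfolding ig_moment_variety_def zariski_closure_def by blast

lemma ig_point_in_ig_moment_point: "ig_point d \<mu> l \<in> ig_moment_point d \<mu> l"
  unfolding ig_moment_point_def proj_point_def by (intro CollectI exI[of _ 1]) simp

lemma ig_moment_point_in_proj_space: "ig_moment_point d \<mu> l \<in> proj_space d"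
  unfolding ig_moment_point_def proj_space_def
  by (intro CollectI exI[of _ "ig_point d \<mu> l"]) (auto intro!: exI[of _ 0])

lemma ig_ideal_vanishes:
  assumes "p \<in> ig_ideal d"
  shows "p \<in> mpolys d" "beval d p = 0"
proof -
  \<comment> \<open>\<open>J\<close> is an ideal containing all generators of the vanishing ideal,
    so minimality of the generated ideal puts the latter inside \<open>J\<close>.\<close>
  define J where "J = {p \<in> mpolys d. \<forall>\<mu> l. l \<noteq> 0 \<longrightarrow> eval_mpoly (ig_point d \<mu> l) p = 0}"
  have "ideal J (mpoly_ring d)"
  proof (rule idealI)
    show "ring (mpoly_ring d)" by (rule ring_mpoly_ring)
    interpret R: ring "mpoly_ring d" by (rule ring_mpoly_ring)
    show "subgroup J (add_monoid (mpoly_ring d))"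
    proof (rule R.add.subgroupI)
      show "J \<subseteq> carrier (mpoly_ring d)" by (auto simp: J_def)
      have "0 \<in> J" by (simp add: J_def mpolys_closed)
      then show "J \<noteq> {}" by blast
    next
      fix a assume "a \<in> J"
      then show "\<ominus>\<^bsub>mpoly_ring d\<^esub> a \<in> J"
        by (auto simp: J_def a_inv_mpoly_ring mpolys_closed eval_mpoly_uminus)
    next
      fix a b assume "a \<in> J" "b \<in> J"
      then show "a \<oplus>\<^bsub>mpoly_ring d\<^esub> b \<in> J"
        by (auto simp: J_def mpolys_closed eval_mpoly_add)
    qed
  next
    fix a x assume "a \<in> J" "x \<in> carrier (mpoly_ring d)"
    then show "x \<otimes>\<^bsub>mpoly_ring d\<^esub> a \<in> J" "a \<otimes>\<^bsub>mpoly_ring d\<^esub> x \<in> J"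
      by (auto simp: J_def mpolys_closed eval_mpoly_mult)
  qed
  moreover have "{f \<in> (\<Union>n. forms d n). \<forall>P\<in>ig_moment_variety d. vanishes_at f P} \<subseteq> J"
  proof
    fix f assume "f \<in> {f \<in> (\<Union>n. forms d n). \<forall>P\<in>ig_moment_variety d. vanishes_at f P}"
    then have f: "f \<in> (\<Union>n. forms d n)" "\<And>P. P \<in> ig_moment_variety d \<Longrightarrow> vanishes_at f P"
      by auto
    have "f \<in> mpolys d" using f(1) forms_subset_mpolys by auto
    moreover have "eval_mpoly (ig_point d \<mu> l) f = 0" if "l \<noteq> 0" for \<mu> l
      using f(2)[OF ig_moment_points_subset_variety[OF that]] ig_point_in_ig_moment_point
      unfolding vanishes_at_def by (rule bspec)
    ultimately show "f \<in> J" unfolding J_def by simp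
  qed
  ultimately have "ig_ideal d \<subseteq> J"
    unfolding vanishing_ideal_def by (rule ring.genideal_minimal[OF ring_mpoly_ring])
  then show "p \<in> mpolys d" "beval d p = 0"
    using assms beval_eq_0_iff[of p d] by (auto simp: J_def)
qed

text \<open>A form killed by \<open>beval\<close> vanishes at every moment point, for all
  representatives by homogeneity. Its zero locus is then a closed set containing these points, hence
  contains their closure.\<close>

lemma form_in_ig_ideal_iff:
  assumes p: "p \<in> forms d n"
  shows "p \<in> ig_ideal d \<longleftrightarrow> beval d p = 0"
proof
  assume "beval d p = 0"
  moreover have pd: "p \<in> mpolys d" using p forms_subset_mpolys by blast
  ultimately have zero: "eval_mpoly (ig_point d \<mu> l) p = 0" if "l \<noteq> 0" for \<mu> l
    using beval_eq_0_iff that by blast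
  have "vanishes_at p (ig_moment_point d \<mu> l)" if "l \<noteq> 0" for \<mu> l
    unfolding vanishes_at_def ig_moment_point_def proj_point_def
  proof
    fix x assume "x \<in> {(\<lambda>i. c * ig_point d \<mu> l i) | c. c \<noteq> 0}"
    then obtain c where "x = (\<lambda>i. c * ig_point d \<mu> l i)" by blast
    then show "eval_mpoly x p = 0"
      by (simp only: eval_mpoly_form_scaled[OF p] zero[OF that] mult_zero_right)
  qed
  then have "{ig_moment_point d \<mu> l | \<mu> l. l \<noteq> 0} \<subseteq> zero_locus d {p}"
    using ig_moment_point_in_proj_space unfolding zero_locus_def by blast
  moreover have "zariski_closed d (zero_locus d {p})"
    unfolding zariski_closed_def by (intro exI[of _ "{p}"]) (use p in auto)
  ultimately have "ig_moment_variety d \<subseteq> zero_locus d {p}"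
    unfolding ig_moment_variety_def zariski_closure_def by (intro Inter_lower) simp
  then have "\<forall>P\<in>ig_moment_variety d. vanishes_at p P"
    by (auto simp: zero_locus_def)
  then have "p \<in> {f \<in> (\<Union>n. forms d n). \<forall>P\<in>ig_moment_variety d. vanishes_at f P}"
    using p by blast
  also have "\<dots> \<subseteq> ig_ideal d"
    unfolding vanishing_ideal_def
    by (rule ring.genideal_self[OF ring_mpoly_ring]) (use forms_subset_mpolys in auto)
  finally show "p \<in> ig_ideal d" .
qed (rule ig_ideal_vanishes)

section \<open>Dimensions of the graded parts of the quotient\<close>

lemma forms_diff: "p \<in> forms d n \<Longrightarrow> q \<in> forms d n \<Longrightarrow> p - q \<in> forms d n"
  using Poly_Mapping.keys_add[of p "- q"] by (auto simp: forms_eq)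

lemma coset_eq_iff:
  assumes "p \<in> forms d n" "q \<in> forms d n"
  shows "ig_ideal d +>\<^bsub>mpoly_ring d\<^esub> p = ig_ideal d +>\<^bsub>mpoly_ring d\<^esub> q \<longleftrightarrow> beval d p = beval d q"
proof -
  have pq: "p \<in> mpolys d" "q \<in> mpolys d"
    using assms forms_subset_mpolys by blast+
  then have "ig_ideal d +>\<^bsub>mpoly_ring d\<^esub> p = ig_ideal d +>\<^bsub>mpoly_ring d\<^esub> q \<longleftrightarrow> p - q \<in> ig_ideal d"
    using ring.quotient_eq_iff_same_a_r_cos[OF ring_mpoly_ring ideal_ig_ideal, of p d q]
    by (simp add: a_minus_mpoly_ring)
  then show ?thesis
    by (simp add: form_in_ig_ideal_iff[OF forms_diff[OF assms]] beval_diff)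
qed

text \<open>Dimension over the constants is built up by line extensions, so the monomials of
  \<open>B\<close> are added one at a time. Independence of their images under \<open>beval\<close>
  keeps each new coset outside the earlier space.\<close>

lemma dimension_image_of_span:
  assumes "B \<subseteq> hom_monomials d n" "inj_on (bmon d) B" "bvs.independent (bmon d ` B)"
  shows "ring.dimension (mpoly_ring d Quot ig_ideal d) (card B)
    ((\<lambda>p. ig_ideal d +>\<^bsub>mpoly_ring d\<^esub> p) ` constants)
    ((\<lambda>p. ig_ideal d +>\<^bsub>mpoly_ring d\<^esub> p) ` {p. Poly_Mapping.keys p \<subseteq> B})"
proof -
  let ?q = "\<lambda>p. ig_ideal d +>\<^bsub>mpoly_ring d\<^esub> p"
  let ?Q = "mpoly_ring d Quot ig_ideal d"
  interpret q: ring_hom_ring "mpoly_ring d" ?Q ?q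
    by (rule ideal.rcos_ring_hom_ring[OF ideal_ig_ideal])
  have "finite B" using assms(1) by (rule finite_subset) simp
  then show ?thesis using assms
  proof (induction B)
    case empty
    have "?q ` {p. Poly_Mapping.keys p \<subseteq> {}} = {\<zero>\<^bsub>?Q\<^esub>}"
      using q.hom_zero by auto
    then show ?case by simp
  next
    case (insert b B)
    have forms: "p \<in> forms d n" if "Poly_Mapping.keys p \<subseteq> insert b B" for p
      using that insert.prems(1) by (auto simp: forms_eq)
    let ?b = "Poly_Mapping.single b (1 :: complex)"
    have b: "?b \<in> mpolys d"
      using forms[of ?b] forms_subset_mpolys by auto
    have carr: "p \<in> mpolys d" if "Poly_Mapping.keys p \<subseteq> B" for p
      using forms[of p] that forms_subset_mpolys by auto
    have "bmon d b \<notin> bmon d ` B"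
      using insert.prems(2) insert.hyps(2) by auto
    then have new: "bmon d b \<notin> bvs.span (bmon d ` B)" and indep: "bvs.independent (bmon d ` B)"
      using insert.prems(3) by (simp_all add: bvs.independent_insert)
    have "?q ?b \<notin> ?q ` {p. Poly_Mapping.keys p \<subseteq> B}"
    proof
      assume "?q ?b \<in> ?q ` {p. Poly_Mapping.keys p \<subseteq> B}"
      then obtain p where p: "Poly_Mapping.keys p \<subseteq> B" "?q ?b = ?q p" by blast
      have "?b \<in> forms d n" "p \<in> forms d n" using forms[of ?b] forms[of p] p by auto
      then have "bmon d b = beval d p"
        using p(2) coset_eq_iff[of ?b d n p] beval_single[of d b 1] by (simp add: bvs.scale_one)
      then show False using new p(1) by (auto simp: span_bmon_eq)
    qed
    moreover have "ring.dimension ?Q (card B) (?q ` constants) (?q ` {p. Poly_Mapping.keys p \<subseteq> B})"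
      using insert.IH insert.prems indep by (auto simp: inj_on_def)
    ultimately have "ring.dimension ?Q (Suc (card B)) (?q ` constants)
        (q.S.line_extension (?q ` constants) (?q ?b) (?q ` {p. Poly_Mapping.keys p \<subseteq> B}))"
      using b by (intro q.S.dimension.Suc_dim) (auto intro!: q.hom_closed)
    moreover have "q.S.line_extension (?q ` constants) (?q ?b) (?q ` {p. Poly_Mapping.keys p \<subseteq> B}) =
        ?q ` {p. Poly_Mapping.keys p \<subseteq> insert b B}"
    proof (intro equalityI subsetI)
      fix u assume "u \<in> q.S.line_extension (?q ` constants) (?q ?b) (?q ` {p. Poly_Mapping.keys p \<subseteq> B})"
      then obtain c p where c: "Poly_Mapping.keys p \<subseteq> B"
        "u = ?q (Poly_Mapping.single 0 c) \<otimes>\<^bsub>?Q\<^esub> ?q ?b \<oplus>\<^bsub>?Q\<^esub> ?q p"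
        unfolding q.S.line_extension_mem_iff constants_def by blast
      have c0: "Poly_Mapping.single 0 c \<in> mpolys d"
        using constants_subset by (auto simp: constants_def)
      then have "u = ?q (Poly_Mapping.single 0 c * ?b + p)"
        using c b carr[OF c(1)] q.hom_mult[of "Poly_Mapping.single 0 c" ?b]
          q.hom_add[of "Poly_Mapping.single 0 c * ?b" p] by (simp add: mpolys_closed)
      moreover have "Poly_Mapping.keys (Poly_Mapping.single 0 c * ?b + p) \<subseteq> insert b B"
        using Poly_Mapping.keys_add[of "Poly_Mapping.single 0 c * ?b" p] c(1)
        by (auto simp: mult_single split: if_splits)
      ultimately show "u \<in> ?q ` {p. Poly_Mapping.keys p \<subseteq> insert b B}" by blast
    next
      fix u assume "u \<in> ?q ` {p. Poly_Mapping.keys p \<subseteq> insert b B}"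
      then obtain p where p: "Poly_Mapping.keys p \<subseteq> insert b B" "u = ?q p" by blast
      define c where "c = Poly_Mapping.lookup p b"
      define r where "r = Poly_Mapping.update b 0 p"
      have r: "Poly_Mapping.keys r \<subseteq> B"
        using p(1) by (auto simp: r_def keys_update)
      have c0: "Poly_Mapping.single 0 c \<in> mpolys d"
        using constants_subset by (auto simp: constants_def)
      have "p = Poly_Mapping.single 0 c * ?b + r"
        by (rule poly_mapping_eqI) (simp add: mult_single c_def r_def lookup_add lookup_update lookup_single)
      then have "u = ?q (Poly_Mapping.single 0 c) \<otimes>\<^bsub>?Q\<^esub> ?q ?b \<oplus>\<^bsub>?Q\<^esub> ?q r"
        using p(2) c0 b carr[OF r] q.hom_mult[of "Poly_Mapping.single 0 c" ?b]
          q.hom_add[of "Poly_Mapping.single 0 c * ?b" r] by (simp add: mpolys_closed)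
      then show "u \<in> q.S.line_extension (?q ` constants) (?q ?b) (?q ` {p. Poly_Mapping.keys p \<subseteq> B})"
        unfolding q.S.line_extension_mem_iff constants_def using r by blast
    qed
    ultimately show ?case
      using insert.hyps by simp
  qed
qed

text \<open>Modulo the ideal every form agrees with a combination of standard monomials of its
  degree, and their cosets are independent.\<close>

lemma hilbert_function_ig:
  "hilbert_function d (ig_ideal d) n = card (standard_monomials d n)"
proof -
  let ?q = "\<lambda>p. ig_ideal d +>\<^bsub>mpoly_ring d\<^esub> p"
  let ?Q = "mpoly_ring d Quot ig_ideal d"
  let ?S = "standard_monomials d n"
  interpret q: ring_hom_ring "mpoly_ring d" ?Q ?q
    by (rule ideal.rcos_ring_hom_ring[OF ideal_ig_ideal])
  have S: "?S \<subseteq> hom_monomials d n"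
    unfolding standard_monomials_def by (rule standard_indices_subset)
  have basis: "inj_on (bmon d) ?S" "bvs.independent (bmon d ` ?S)"
    "bvs.span (bmon d ` ?S) = bvs.span (bmon d ` hom_monomials d n)"
    unfolding standard_monomials_def using bvs.standard_indices_basis[of "hom_monomials d n" "bmon d"] by auto
  have sub: "p \<in> forms d n" if "Poly_Mapping.keys p \<subseteq> ?S" for p
    using that S by (auto simp: forms_eq)
  have "?q ` forms d n \<subseteq> ?q ` {p. Poly_Mapping.keys p \<subseteq> ?S}"
  proof
    fix u assume "u \<in> ?q ` forms d n"
    then obtain p where p: "p \<in> forms d n" "u = ?q p" by blast
    then have "beval d p \<in> bvs.span (bmon d ` ?S)"
      unfolding basis(3) by (auto simp: span_bmon_eq forms_eq)
    then obtain p' where "Poly_Mapping.keys p' \<subseteq> ?S" "beval d p = beval d p'"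
      by (auto simp: span_bmon_eq)
    then show "u \<in> ?q ` {p. Poly_Mapping.keys p \<subseteq> ?S}"
      using p coset_eq_iff[OF p(1) sub[of p']] by blast
  qed
  then have eq: "?q ` forms d n = ?q ` {p. Poly_Mapping.keys p \<subseteq> ?S}"
    using sub by blast
  \<comment> \<open>The quotient ring is nonzero, which is what makes the image of the constants a
    subfield.\<close>
  have "\<one>\<^bsub>?Q\<^esub> \<noteq> \<zero>\<^bsub>?Q\<^esub>"
  proof -
    have "(1 :: mpoly) \<in> forms d 0" "(0 :: mpoly) \<in> forms d 0"
      by (simp_all add: forms_eq hom_monomials_def monom_degree_def)
    moreover have "beval d 1 = 1"
      using beval_single[of d 0 1] by simp
    ultimately have "?q 1 \<noteq> ?q 0"
      by (simp add: coset_eq_iff)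
    then show ?thesis using q.hom_one q.hom_zero by simp
  qed
  then have "subfield (?q ` constants) ?Q"
    by (rule q.img_is_subfield(2)[OF subfield_constants])
  then have "ring.dim ?Q (?q ` constants) (?q ` forms d n) = card ?S"
    unfolding eq using q.S.dimI[OF _ dimension_image_of_span[OF S basis(1,2)]]
    by (simp add: over_def)
  then show ?thesis
    by (simp add: hilbert_function_def Let_def)
qed

lemma eventually_poly_hilbert_function:
  "eventually_poly (\<lambda>n. of_nat (hilbert_function d (ig_ideal d) n))"
  unfolding hilbert_function_ig by (rule eventually_poly_card_standard_monomials)

lemma hilbert_function_le:
  assumes "finite T" "bmon d ` hom_monomials d n \<subseteq> bvs.span T"
  shows "hilbert_function d (ig_ideal d) n \<le> card T"
proof -
  have "inj_on (bmon d) (standard_monomials d n)" "bvs.independent (bmon d ` standard_monomials d n)"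
    unfolding standard_monomials_def using bvs.standard_indices_basis[of "hom_monomials d n" "bmon d"] by auto
  moreover have "bmon d ` standard_monomials d n \<subseteq> bvs.span T"
    using assms(2) standard_indices_subset[of bvs.span "bmon d"] unfolding standard_monomials_def by blast
  ultimately show ?thesis
    unfolding hilbert_function_ig using bvs.independent_span_bound[OF assms(1)] by (metis card_image)
qed

lemma hilbert_function_ge:
  assumes "finite I" "g ` I \<subseteq> bvs.span (bmon d ` hom_monomials d n)"
    "\<And>c. (\<Sum>i\<in>I. bscale (c i) (g i)) = 0 \<Longrightarrow> \<forall>i\<in>I. c i = 0"
  shows "card I \<le> hilbert_function d (ig_ideal d) n"
proof -
  have basis: "inj_on (bmon d) (standard_monomials d n)"
    "bvs.span (bmon d ` standard_monomials d n) = bvs.span (bmon d ` hom_monomials d n)"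
    unfolding standard_monomials_def using bvs.standard_indices_basis[of "hom_monomials d n" "bmon d"] by auto
  have "finite (standard_monomials d n)"
    unfolding standard_monomials_def
    by (rule finite_subset[OF standard_indices_subset finite_hom_monomials])
  then have "card I \<le> card (bmon d ` standard_monomials d n)"
    using assms by (intro bvs.card_le_if_no_linear_relation[of I _ g]) (simp_all add: basis(2))
  then show ?thesis
    unfolding hilbert_function_ig by (simp add: card_image[OF basis(1)])
qed

section \<open>The upper bound\<close>

context
  fixes d n :: nat
  assumes d: "d \<ge> 1"
begin

lemma sum_lookup_hom_monomial:
  assumes "m \<in> hom_monomials d n"
  shows "(\<Sum>i\<le>d. Poly_Mapping.lookup m i) = n"
  using assms monom_degree_eq_sum[of "{..d}" m]
  by (auto simp: hom_monomials_def monomials_def lessThan_Suc_atMost)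

text \<open>The deficit \<open>n * d - w\<close> is the sum of \<open>d - i\<close> over all
  factors, so it is at least the number of factors of index below \<open>d\<close>. The last bound
  adds up \<open>d * (i - 1) \<le> i * (d - 1)\<close>, which holds for every index up to
  \<open>d\<close>.\<close>

lemma weight_bounds:
  assumes "m \<in> hom_monomials d n"
  defines "w \<equiv> (\<Sum>i\<le>d. i * Poly_Mapping.lookup m i)"
  shows "w \<le> n * d" "n - (n * d - w) \<le> Poly_Mapping.lookup m d"
    "d * (\<Sum>i\<le>d. (i - 1) * Poly_Mapping.lookup m i) \<le> w * (d - 1)"
proof -
  let ?l = "Poly_Mapping.lookup m"
  have n: "(\<Sum>i\<le>d. ?l i) = n" by (rule sum_lookup_hom_monomial[OF assms(1)])
  have "w + (\<Sum>i\<le>d. (d - i) * ?l i) = (\<Sum>i\<le>d. d * ?l i)"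
    unfolding w_def sum.distrib[symmetric]
    by (intro sum.cong refl) (simp flip: add_mult_distrib)
  also have "\<dots> = n * d"
    by (simp add: n mult.commute flip: sum_distrib_left)
  finally have e: "w + (\<Sum>i\<le>d. (d - i) * ?l i) = n * d" .
  then show "w \<le> n * d" by linarith
  have "n = (\<Sum>i<d. ?l i) + ?l d"
    using n by (simp add: lessThan_Suc_atMost[symmetric])
  also have "(\<Sum>i<d. ?l i) \<le> (\<Sum>i<d. (d - i) * ?l i)"
    by (intro sum_mono) (simp add: Suc_leI)
  also have "\<dots> \<le> (\<Sum>i\<le>d. (d - i) * ?l i)"
    by (intro sum_mono2) auto
  also have "\<dots> = n * d - w" using e by linarith
  finally show "n - (n * d - w) \<le> ?l d" by simp
  have le: "d * (i - 1) \<le> i * (d - 1)" if "i \<le> d" for i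
    using that by (cases i; cases d) (auto simp: algebra_simps)
  have "(\<Sum>i\<le>d. d * ((i - 1) * ?l i)) \<le> (\<Sum>i\<le>d. (d - 1) * (i * ?l i))"
  proof (intro sum_mono)
    fix i assume "i \<in> {..d}"
    then have "d * (i - 1) * ?l i \<le> i * (d - 1) * ?l i"
      using le by (intro mult_le_mono1) simp
    then show "d * ((i - 1) * ?l i) \<le> (d - 1) * (i * ?l i)"
      by (simp only: ac_simps)
  qed
  then show "d * (\<Sum>i\<le>d. (i - 1) * ?l i) \<le> w * (d - 1)"
    unfolding w_def by (simp add: sum_distrib_left mult.commute)
qed

text \<open>Weight \<open>n * d - e\<close> is reached by at most \<open>e\<close> factors different from the last variable,
  so the image of a monomial of that weight is divisible by the power \<open>n - e\<close> of \<open>bessel d\<close>.\<close>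

definition upper_spanning_set :: "complex poly poly set" where
  "upper_spanning_set = (\<Union>w\<le>n * d. (\<lambda>k. Polynomial.monom (bessel d ^ (n - (n * d - w)) * Polynomial.monom 1 k) w) `
     {k. d * (k + (n - (n * d - w)) * (d - 1)) \<le> w * (d - 1)})"

text \<open>After the guaranteed power of \<open>bessel d\<close> is split off, the third weight
  bound limits the degree of the cofactor \<open>q\<close>, which is then expanded into powers of
  the inner variable.\<close>

lemma bmon_in_span_upper_spanning_set:
  assumes "m \<in> hom_monomials d n"
  shows "bmon d m \<in> bvs.span upper_spanning_set"
proof -
  let ?l = "Poly_Mapping.lookup m"
  define w where "w = (\<Sum>i\<le>d. i * ?l i)"
  define r where "r = n - (n * d - w)"
  note bounds = weight_bounds[OF assms, folded w_def]
  let ?P = "\<Prod>i\<le>d. bessel i ^ ?l i"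
  have "bessel d ^ r dvd bessel d ^ ?l d"
    using bounds(2) by (simp add: r_def le_imp_power_dvd)
  also have "\<dots> dvd ?P" by (rule dvd_prodI) auto
  finally obtain q where q: "?P = bessel d ^ r * q" by (elim dvdE)
  have ne: "?P \<noteq> 0" by simp
  have "degree ?P = (\<Sum>i\<le>d. (i - 1) * ?l i)"
    by (subst degree_prod_eq_sum_degree) (auto simp: degree_power_eq degree_bessel mult.commute)
  moreover have "degree ?P = r * (d - 1) + degree q"
    using ne unfolding q by (subst degree_mult_eq) (auto simp: degree_power_eq degree_bessel)
  ultimately have deg: "d * (degree q + r * (d - 1)) \<le> w * (d - 1)"
    using bounds(3) by (simp add: add.commute)
  have "bmon d m = Polynomial.monom (bessel d ^ r * (\<Sum>k\<le>degree q. Polynomial.smult (poly.coeff q k) (Polynomial.monom 1 k))) w"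
    unfolding bmon_def q w_def[symmetric] by (simp add: smult_monom poly_as_sum_of_monoms)
  also have "\<dots> = (\<Sum>k\<le>degree q. bscale (poly.coeff q k) (Polynomial.monom (bessel d ^ r * Polynomial.monom 1 k) w))"
    by (simp add: bscale_monom sum_distrib_left monom_sum)
  also have "\<dots> \<in> bvs.span upper_spanning_set"
  proof (intro bvs.span_sum bvs.span_scale bvs.span_base)
    fix k assume "k \<in> {..degree q}"
    then have "d * (k + r * (d - 1)) \<le> d * (degree q + r * (d - 1))" by simp
    with deg have "d * (k + r * (d - 1)) \<le> w * (d - 1)" by linarith
    then show "Polynomial.monom (bessel d ^ r * Polynomial.monom 1 k) w \<in> upper_spanning_set"
      unfolding upper_spanning_set_def r_def using bounds(1) by blast
  qed
  finally show ?thesis .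
qed

lemma card_bounded_multiples:
  assumes "d * s \<le> W"
  shows "finite {k. d * (k + s) \<le> W}"
    "of_nat (card {k. d * (k + s) \<le> W}) \<le> of_nat W / of_nat d - of_nat s + (1 :: rat)"
proof -
  have sub: "{k. d * (k + s) \<le> W} \<subseteq> {..W div d - s}"
  proof
    fix k assume "k \<in> {k. d * (k + s) \<le> W}"
    then have "k + s \<le> W div d"
      using d by (simp add: less_eq_div_iff_mult_less_eq mult.commute)
    then show "k \<in> {..W div d - s}" by simp
  qed
  then show "finite {k. d * (k + s) \<le> W}" by (rule finite_subset) simp
  \<comment> \<open>This makes the natural subtraction in \<open>W div d - s\<close> exact, so that
    it survives the passage to rationals.\<close>
  have s: "s \<le> W div d"
    using d assms by (simp add: less_eq_div_iff_mult_less_eq mult.commute)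
  have "card {k. d * (k + s) \<le> W} \<le> W div d - s + 1"
    using card_mono[OF _ sub] by simp
  then have "rat_of_nat (card {k. d * (k + s) \<le> W}) \<le> of_nat (W div d - s + 1)"
    by (simp only: of_nat_le_iff)
  also have "\<dots> = of_nat (W div d) - of_nat s + 1"
    using s by (simp add: of_nat_diff)
  also have "rat_of_nat (W div d) \<le> of_nat W / of_nat d"
  proof -
    have "rat_of_nat (d * (W div d)) \<le> of_nat W"
      unfolding of_nat_le_iff by simp
    then show ?thesis using d by (simp add: field_simps)
  qed
  finally show "of_nat (card {k. d * (k + s) \<le> W}) \<le> of_nat W / of_nat d - of_nat s + (1 :: rat)"
    by simp
qed

lemma sum_truncated: "(\<Sum>w\<le>n * d. n - (n * d - w)) = (\<Sum>e\<le>n. e)"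
proof -
  have "(\<Sum>w\<le>n * d. n - (n * d - w)) = (\<Sum>e\<le>n * d. n - e)"
    by (rule sum.reindex_bij_witness[of _ "\<lambda>e. n * d - e" "\<lambda>w. n * d - w"]) auto
  \<comment> \<open>Deficits beyond \<open>n\<close> contribute 0 by truncation, and
    \<open>d \<ge> 1\<close> ensures that all deficits up to \<open>n\<close> occur.\<close>
  also have "\<dots> = (\<Sum>e\<le>n. n - e)"
    using d by (intro sum.mono_neutral_right) auto
  also have "\<dots> = (\<Sum>e\<le>n. e)"
    by (rule sum.reindex_bij_witness[of _ "\<lambda>e. n - e" "\<lambda>e. n - e"]) auto
  finally show ?thesis .
qed

text \<open>Each weight contributes at most w (d - 1) / d - r (d - 1) + 1 elements, with r the
  exponent of \<open>bessel d\<close>. On summation the linear terms of the first two parts cancel,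
  and the 1 contributes n d + 1.\<close>

lemma upper_spanning_set_card:
  "finite upper_spanning_set"
  "of_nat (card upper_spanning_set) \<le> (of_nat d - 1) ^ 2 / 2 * of_nat n ^ 2 + of_nat d * of_nat n + (1 :: rat)"
proof -
  let ?r = "\<lambda>w. n - (n * d - w)"
  let ?K = "\<lambda>w. {k. d * (k + ?r w * (d - 1)) \<le> w * (d - 1)}"
  have room: "d * (?r w * (d - 1)) \<le> w * (d - 1)" if "w \<le> n * d" for w
  proof -
    \<comment> \<open>The power of \<open>bessel d\<close> split off fits into the degree allowed at
      weight \<open>w\<close>: for the deficit \<open>e\<close>, d (n - e) is at most d n - e =
      w.\<close>
    define e where "e = n * d - w"
    have "e \<le> d * e" using d by simp
    moreover have "d * n = w + e" using that by (simp add: e_def mult.commute)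
    ultimately have "d * (n - e) \<le> w" unfolding diff_mult_distrib2 by linarith
    then have "d * (n - e) * (d - 1) \<le> w * (d - 1)" by (rule mult_le_mono1)
    then show ?thesis by (simp add: e_def mult.assoc)
  qed
  note K = card_bounded_multiples[OF room]
  show "finite upper_spanning_set"
    unfolding upper_spanning_set_def using K(1) by blast
  have "card upper_spanning_set \<le> (\<Sum>w\<le>n * d. card ((\<lambda>k. Polynomial.monom (bessel d ^ ?r w * Polynomial.monom 1 k) w) ` ?K w))"
    unfolding upper_spanning_set_def by (rule card_UN_le) simp
  also have "\<dots> \<le> (\<Sum>w\<le>n * d. card (?K w))"
    by (intro sum_mono card_image_le K(1)) simp
  finally have "rat_of_nat (card upper_spanning_set) \<le> of_nat (\<Sum>w\<le>n * d. card (?K w))"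
    by (simp only: of_nat_le_iff)
  also have "\<dots> = (\<Sum>w\<le>n * d. of_nat (card (?K w)))" by simp
  also have "\<dots> \<le> (\<Sum>w\<le>n * d. of_nat (w * (d - 1)) / of_nat d - of_nat (?r w * (d - 1)) + 1)"
    by (intro sum_mono K(2)) simp
  also have "\<dots> = (of_nat d - 1) / of_nat d * of_nat (\<Sum>w\<le>n * d. w) - (of_nat d - 1) * of_nat (\<Sum>w\<le>n * d. ?r w) + of_nat (n * d + 1)"
  proof -
    have "rat_of_nat (d - 1) = of_nat d - 1" using d by (simp add: of_nat_diff)
    then have summand: "rat_of_nat (w * (d - 1)) / of_nat d - of_nat (r * (d - 1)) + 1 =
        (of_nat d - 1) / of_nat d * of_nat w - (of_nat d - 1) * of_nat r + 1" for w r
      unfolding of_nat_mult by simp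
    show ?thesis
      unfolding summand sum.distrib sum_subtractf sum_distrib_left[symmetric] of_nat_sum by simp
  qed
  also have "\<dots> = (of_nat d - 1) ^ 2 / 2 * of_nat n ^ 2 + of_nat d * of_nat n + (1 :: rat)"
  proof -
    have gauss: "rat_of_nat (\<Sum>w\<le>k. w) = of_nat k * (of_nat k + 1) / 2" for k
      by (induction k) (simp_all add: field_simps)
    show ?thesis
      unfolding sum_truncated gauss using d
      by (simp add: field_simps power2_eq_square)
  qed
  finally show "of_nat (card upper_spanning_set) \<le> (of_nat d - 1) ^ 2 / 2 * of_nat n ^ 2 + of_nat d * of_nat n + (1 :: rat)" .
qed

lemma hilbert_function_upper:
  "of_nat (hilbert_function d (ig_ideal d) n) \<le> (of_nat d - 1) ^ 2 / 2 * of_nat n ^ 2 + of_nat d * of_nat n + (1 :: rat)"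
proof -
  have "hilbert_function d (ig_ideal d) n \<le> card upper_spanning_set"
    using bmon_in_span_upper_spanning_set by (intro hilbert_function_le upper_spanning_set_card(1)) blast
  then have "rat_of_nat (hilbert_function d (ig_ideal d) n) \<le> of_nat (card upper_spanning_set)"
    by (simp only: of_nat_le_iff)
  then show ?thesis using upper_spanning_set_card(2) by (rule order_trans)
qed

end

section \<open>The lower bound\<close>

text \<open>Among the terms of one weight, the second exponents differ by multiples of \<open>e\<close>; hence the
  one with the least second exponent must have its coefficient divisible by \<open>b ^ e\<close>.\<close>

lemma no_relation_over_coprime_powers:
  fixes a b :: "complex poly" and p :: "nat \<times> nat \<Rightarrow> complex poly"
  assumes "coprime a b" "b \<noteq> 0" "a \<noteq> 0" "e \<ge> 1" "finite K"
    and deg: "\<And>\<kappa>. \<kappa> \<in> K \<Longrightarrow> degree (p \<kappa>) < e * degree b"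
    and zero: "(\<Sum>\<kappa>\<in>K. Polynomial.monom (p \<kappa> * (a ^ fst \<kappa> * b ^ snd \<kappa>)) (e * fst \<kappa> + (e + 1) * snd \<kappa> + s)) = 0"
  shows "\<forall>\<kappa>\<in>K. p \<kappa> = 0"
proof (rule ccontr)
  assume "\<not> (\<forall>\<kappa>\<in>K. p \<kappa> = 0)"
  then obtain \<kappa> where \<kappa>: "\<kappa> \<in> K" "p \<kappa> \<noteq> 0"
    and least: "\<And>\<kappa>'. \<kappa>' \<in> K \<Longrightarrow> p \<kappa>' \<noteq> 0 \<Longrightarrow> snd \<kappa> \<le> snd \<kappa>'"
    using ex_has_least_nat[of "\<lambda>\<kappa>. \<kappa> \<in> K \<and> p \<kappa> \<noteq> 0" _ snd] by blast
  let ?t = "\<lambda>\<kappa>. p \<kappa> * (a ^ fst \<kappa> * b ^ snd \<kappa>)"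
  let ?w = "\<lambda>\<kappa>. e * fst \<kappa> + (e + 1) * snd \<kappa> + s"
  \<comment> \<open>Only the terms with the weight of the chosen \<open>\<kappa>\<close> reach this
    coefficient, so its term is minus the sum of the others of that weight.\<close>
  have "poly.coeff (\<Sum>\<kappa>\<in>K. Polynomial.monom (?t \<kappa>) (?w \<kappa>)) (?w \<kappa>) =
      (\<Sum>\<kappa>'\<in>K. if ?w \<kappa>' = ?w \<kappa> then ?t \<kappa>' else 0)"
    by (simp only: coeff_sum coeff_monom)
  also have "\<dots> = ?t \<kappa> + (\<Sum>\<kappa>'\<in>K - {\<kappa>}. if ?w \<kappa>' = ?w \<kappa> then ?t \<kappa>' else 0)"
    by (subst sum.remove[OF assms(5) \<kappa>(1)]) simp
  finally have eq: "?t \<kappa> = - (\<Sum>\<kappa>'\<in>K - {\<kappa>}. if ?w \<kappa>' = ?w \<kappa> then ?t \<kappa>' else 0)"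
    unfolding zero by (simp add: eq_neg_iff_add_eq_0)
  have "b ^ (snd \<kappa> + e) dvd (\<Sum>\<kappa>'\<in>K - {\<kappa>}. if ?w \<kappa>' = ?w \<kappa> then ?t \<kappa>' else 0)"
  proof (rule dvd_sum)
    fix \<kappa>' assume \<kappa>': "\<kappa>' \<in> K - {\<kappa>}"
    show "b ^ (snd \<kappa> + e) dvd (if ?w \<kappa>' = ?w \<kappa> then ?t \<kappa>' else 0)"
    proof (cases "?w \<kappa>' = ?w \<kappa> \<and> p \<kappa>' \<noteq> 0")
      case True
      then have le: "snd \<kappa> \<le> snd \<kappa>'" using least \<kappa>' by blast
      have w: "e * fst \<kappa>' + (e + 1) * snd \<kappa>' = e * fst \<kappa> + (e + 1) * snd \<kappa>"
        using True by simp
      \<comment> \<open>Equal weights and equal second exponents force equal first exponents because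
        \<open>e \<ge> 1\<close>.\<close>
      have "snd \<kappa>' \<noteq> snd \<kappa>"
        using w \<kappa>' assms(4) by (cases \<kappa>; cases \<kappa>') auto
      then have pos: "snd \<kappa>' - snd \<kappa> > 0" using le by simp
      \<comment> \<open>Since \<open>e + 1\<close> is 1 modulo \<open>e\<close>, this divisibility
        passes to the difference of the second exponents, which is positive and hence at least
        \<open>e\<close>.\<close>
      have "e dvd (e + 1) * (snd \<kappa>' - snd \<kappa>)"
      proof -
        have "(e + 1) * (snd \<kappa>' - snd \<kappa>) = e * (fst \<kappa> - fst \<kappa>')"
          unfolding diff_mult_distrib2 using w by linarith
        then show ?thesis by simp
      qed
      then have "e dvd snd \<kappa>' - snd \<kappa>"
        by (simp only: add_mult_distrib mult_1 dvd_add_right_iff[OF dvd_triv_left])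
      then have "e \<le> snd \<kappa>' - snd \<kappa>" using pos by (rule dvd_imp_le)
      then have "b ^ (snd \<kappa> + e) dvd b ^ snd \<kappa>'"
        using pos by (intro le_imp_power_dvd) linarith
      then show ?thesis by (auto intro: dvd_mult)
    qed auto
  qed
  then have "b ^ (snd \<kappa> + e) dvd ?t \<kappa>" unfolding eq by simp
  then have "b ^ snd \<kappa> * b ^ e dvd b ^ snd \<kappa> * (p \<kappa> * a ^ fst \<kappa>)"
    by (simp only: power_add ac_simps)
  \<comment> \<open>Coprimality with \<open>a\<close> leaves \<open>b ^ e\<close> as a divisor of
    \<open>p \<kappa>\<close> itself, against the degree bound.\<close>
  then have "b ^ e dvd p \<kappa> * a ^ fst \<kappa>"
    using assms(2) by (simp only: dvd_mult_cancel_left power_eq_0_iff) simp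
  moreover have "coprime (b ^ e) (a ^ fst \<kappa>)"
    using assms(1) by (simp add: coprime_commute)
  ultimately have "b ^ e dvd p \<kappa>"
    by (simp only: coprime_dvd_mult_left_iff)
  then have "degree (b ^ e) \<le> degree (p \<kappa>)"
    using \<kappa>(2) by (rule dvd_imp_degree_le)
  then show False
    using deg[OF \<kappa>(1)] assms(2) by (simp add: degree_power_eq)
qed

section \<open>Elements in the span of products of \<open>n\<close> moments\<close>

abbreviation bmon_span :: "nat \<Rightarrow> nat \<Rightarrow> complex poly poly set" where
  "bmon_span d n \<equiv> bvs.span (bmon d ` hom_monomials d n)"

lemma bmon_span_mult:
  assumes "x \<in> bmon_span d n" "y \<in> bmon_span d k"
  shows "x * y \<in> bmon_span d (n + k)"
  using assms(2)
proof (induction rule: bvs.span_induct_alt)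
  case base
  then show ?case by (simp add: bvs.span_zero)
next
  case (step c y z)
  then obtain m where m: "m \<in> hom_monomials d k" "y = bmon d m" by blast
  have "x * y \<in> bmon_span d (n + k)"
    unfolding m(2) by (rule mult_in_span_bmon[OF assms(1)]) (rule add_hom_monomials[OF _ m(1)])
  with step(2) show ?case
    by (simp add: distrib_left bscale_mult_right bvs.span_add bvs.span_scale)
qed

lemma bmon_span_1: "1 \<in> bmon_span d 0"
  by (rule bvs.span_base, rule image_eqI[of _ _ 0]) (simp_all add: hom_monomials_def monom_degree_def)

lemma bmon_span_power:
  assumes "x \<in> bmon_span d k"
  shows "x ^ j \<in> bmon_span d (j * k)"
  by (induction j) (use bmon_span_1 bmon_span_mult[OF assms] in auto)

lemma bmon_single:
  assumes "i \<le> d"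
  shows "bmon d (Poly_Mapping.single i k) = Polynomial.monom (bessel i ^ k) (i * k)"
proof -
  have "(\<Prod>j\<le>d. bessel j ^ Poly_Mapping.lookup (Poly_Mapping.single i k) j) = (\<Prod>j\<le>d. if j = i then bessel i ^ k else 1)"
    by (intro prod.cong) (auto simp: lookup_single when_def)
  moreover have "(\<Sum>j\<le>d. j * Poly_Mapping.lookup (Poly_Mapping.single i k) j) = (\<Sum>j\<le>d. if j = i then i * k else 0)"
    by (intro sum.cong) (auto simp: lookup_single when_def)
  ultimately show ?thesis using assms by (simp add: bmon_def)
qed

lemma bmon_span_bessel:
  assumes "i \<le> d"
  shows "Polynomial.monom (bessel i) i \<in> bmon_span d 1"
proof -
  have "bmon d (Poly_Mapping.single i 1) \<in> bmon_span d 1"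
    using assms by (intro bvs.span_base imageI) (simp add: hom_monomials_def single_in_monomials)
  then show ?thesis using bmon_single[OF assms, of 1] by simp
qed

text \<open>With y for the inner variable, the second moment is \<open>\<mu> ^ 2 * (1 + y)\<close>,
  so subtracting the square \<open>\<mu> ^ 2\<close> of the first isolates
  \<open>\<mu> ^ 2 * y\<close>.\<close>

lemma bmon_span_monom_2:
  assumes "d \<ge> 2"
  shows "Polynomial.monom 1 2 \<in> bmon_span d 2" "Polynomial.monom [:0, 1:] 2 \<in> bmon_span d 2"
proof -
  have "Polynomial.monom (bessel 1) 1 * Polynomial.monom (bessel 1) 1 \<in> bmon_span d (1 + 1)"
    using assms by (intro bmon_span_mult bmon_span_bessel) auto
  then show v: "Polynomial.monom 1 2 \<in> bmon_span d 2"
    by (simp add: mult_monom numeral_2_eq_2)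
  have "Polynomial.monom (bessel 2) 2 * Polynomial.monom (bessel 0) 0 \<in> bmon_span d (1 + 1)"
    using assms by (intro bmon_span_mult bmon_span_bessel) auto
  then have "Polynomial.monom [:1, 1:] 2 \<in> bmon_span d 2"
    by (simp add: mult_monom numeral_2_eq_2 one_pCons)
  then have "Polynomial.monom [:1, 1:] 2 - Polynomial.monom 1 2 \<in> bmon_span d 2"
    using v by (rule bvs.span_diff)
  then show "Polynomial.monom [:0, 1:] 2 \<in> bmon_span d 2"
    by (simp add: diff_monom one_pCons)
qed

text \<open>The factors used here are the zeroth, the last two variables, and the two quadrics
  \<open>m\<^sub>1\<^sup>2\<close> and \<open>m\<^sub>0 m\<^sub>2 - m\<^sub>1\<^sup>2\<close>, whose quotient is the inner variable.\<close>

lemma independent_element_in_bmon_span: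
  assumes "d \<ge> 2" "\<gamma> + \<beta> \<le> N" "j < D"
  shows "Polynomial.monom (bessel (d - 1) ^ \<gamma> * bessel d ^ \<beta> * Polynomial.monom 1 j)
      ((d - 1) * \<gamma> + d * \<beta> + 2 * (D - 1)) \<in> bmon_span d (N + 2 * (D - 1))"
proof -
  \<comment> \<open>The zeroth moment, equal to 1, pads the degree up to \<open>N\<close>. Always
    \<open>D - 1\<close> quadrics are used, \<open>j\<close> of them with the factor y, so that
    neither the degree nor the weight depends on \<open>j\<close>.\<close>
  let ?f = "Polynomial.monom (bessel 0) 0 ^ (N - \<gamma> - \<beta>) * (Polynomial.monom (bessel (d - 1)) (d - 1) ^ \<gamma> *
      (Polynomial.monom (bessel d) d ^ \<beta> * (Polynomial.monom 1 2 ^ (D - 1 - j) * Polynomial.monom [:0, 1:] 2 ^ j)))"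
  have x_power: "[:0, 1:] ^ j = Polynomial.monom (1 :: complex) j"
    by (simp add: monom_altdef)
  have "?f \<in> bmon_span d ((N - \<gamma> - \<beta>) * 1 + (\<gamma> * 1 + (\<beta> * 1 + ((D - 1 - j) * 2 + j * 2))))"
    using assms(1) by (intro bmon_span_mult bmon_span_power bmon_span_bessel bmon_span_monom_2) auto
  also have "(N - \<gamma> - \<beta>) * 1 + (\<gamma> * 1 + (\<beta> * 1 + ((D - 1 - j) * 2 + j * 2))) = N + 2 * (D - 1)"
    using assms(2,3) by simp
  also have "?f = Polynomial.monom (bessel (d - 1) ^ \<gamma> * bessel d ^ \<beta> * Polynomial.monom 1 j)
      ((d - 1) * \<gamma> + d * \<beta> + (2 * (D - 1 - j) + 2 * j))"
    by (simp add: monom_power mult_monom x_power ac_simps)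
  also have "2 * (D - 1 - j) + 2 * j = 2 * (D - 1)"
    using assms(3) by simp
  finally show ?thesis .
qed

text \<open>The elements are indexed by pairs of exponents with sum at most \<open>N\<close> and by
  \<open>j < D\<close>. The value of \<open>D\<close> is \<open>(d - 1) * degree (bessel d)\<close>,
  the exact degree threshold of \<open>no_relation_over_coprime_powers\<close> for
  \<open>e = d - 1\<close>.\<close>

lemma hilbert_function_lower:
  assumes "d \<ge> 2" "D = (d - 1) ^ 2"
  shows "D * (\<Sum>\<gamma>\<le>N. N - \<gamma> + 1) \<le> hilbert_function d (ig_ideal d) (N + 2 * (D - 1))"
proof -
  define K where "K = (SIGMA \<gamma>:{..N}. {..N - \<gamma>})"
  define g where "g \<equiv> \<lambda>((\<gamma>, \<beta>), j). Polynomial.monom (bessel (d - 1) ^ \<gamma> * bessel d ^ \<beta> * Polynomial.monom 1 j)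
      ((d - 1) * \<gamma> + d * \<beta> + 2 * (D - 1))"
  have finK: "finite K" by (simp add: K_def)
  have "card (K \<times> {..<D}) \<le> hilbert_function d (ig_ideal d) (N + 2 * (D - 1))"
  proof (rule hilbert_function_ge)
    show "finite (K \<times> {..<D})" using finK by simp
    show "g ` (K \<times> {..<D}) \<subseteq> bmon_span d (N + 2 * (D - 1))"
    proof
      fix x assume "x \<in> g ` (K \<times> {..<D})"
      then obtain \<kappa> j where \<kappa>: "(\<kappa>, j) \<in> K \<times> {..<D}" "x = g (\<kappa>, j)"
        by blast
      obtain \<gamma> \<beta> where "\<kappa> = (\<gamma>, \<beta>)"
        by (rule prod.exhaust)
      with \<kappa> have i: "((\<gamma>, \<beta>), j) \<in> K \<times> {..<D}" "x = g ((\<gamma>, \<beta>), j)"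
        by simp_all
      then have "\<gamma> + \<beta> \<le> N" "j < D"
        by (auto simp: K_def)
      then show "x \<in> bmon_span d (N + 2 * (D - 1))"
        using independent_element_in_bmon_span[OF assms(1)] i(2) by (simp add: g_def)
    qed
  next
    fix c :: "(nat \<times> nat) \<times> nat \<Rightarrow> complex"
    assume zero: "(\<Sum>i\<in>K \<times> {..<D}. bscale (c i) (g i)) = 0"
    \<comment> \<open>For each pair of exponents the scalars are the coefficients of one polynomial
      of degree below \<open>D\<close>, so a linear relation becomes one with polynomial
      coefficients.\<close>
    define p where "p \<kappa> = (\<Sum>j<D. Polynomial.monom (c (\<kappa>, j)) j)" for \<kappa>
    have D: "D = (d - 1) * degree (bessel d)" "D > 0"
      using assms by (simp_all add: degree_bessel power2_eq_square)
    have coeff_p: "poly.coeff (p \<kappa>) j = (if j < D then c (\<kappa>, j) else 0)" for \<kappa> j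
      by (simp add: p_def coeff_sum)
    have deg_p: "degree (p \<kappa>) < D" for \<kappa>
      using D(2) by (intro degree_lessI) (auto simp: coeff_p)
    have "(\<Sum>\<kappa>\<in>K. Polynomial.monom (p \<kappa> * (bessel (d - 1) ^ fst \<kappa> * bessel d ^ snd \<kappa>))
        ((d - 1) * fst \<kappa> + (d - 1 + 1) * snd \<kappa> + 2 * (D - 1))) =
        (\<Sum>\<kappa>\<in>K. \<Sum>j<D. bscale (c (\<kappa>, j)) (g (\<kappa>, j)))"
    proof (intro sum.cong refl)
      fix \<kappa>
      have monom: "Polynomial.monom (c (\<kappa>, j)) j = Polynomial.smult (c (\<kappa>, j)) (Polynomial.monom 1 j)" for j
        by (simp add: smult_monom)
      have "p \<kappa> * (bessel (d - 1) ^ fst \<kappa> * bessel d ^ snd \<kappa>) =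
          (\<Sum>j<D. Polynomial.smult (c (\<kappa>, j)) (bessel (d - 1) ^ fst \<kappa> * bessel d ^ snd \<kappa> * Polynomial.monom 1 j))"
        unfolding p_def sum_distrib_right monom
        by (simp only: mult_smult_left mult_smult_right ac_simps)
      then show "Polynomial.monom (p \<kappa> * (bessel (d - 1) ^ fst \<kappa> * bessel d ^ snd \<kappa>))
          ((d - 1) * fst \<kappa> + (d - 1 + 1) * snd \<kappa> + 2 * (D - 1)) = (\<Sum>j<D. bscale (c (\<kappa>, j)) (g (\<kappa>, j)))"
        using assms(1) by (simp add: g_def case_prod_unfold bscale_monom monom_sum)
    qed
    also have "\<dots> = 0"
      using zero by (simp add: sum.cartesian_product)
    finally have relation: "(\<Sum>\<kappa>\<in>K. Polynomial.monom (p \<kappa> * (bessel (d - 1) ^ fst \<kappa> * bessel d ^ snd \<kappa>))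
        ((d - 1) * fst \<kappa> + (d - 1 + 1) * snd \<kappa> + 2 * (D - 1))) = 0" .
    have "coprime (bessel (d - 1)) (bessel d)"
      using coprime_bessel[of "d - 1"] assms(1) by simp
    then have "\<forall>\<kappa>\<in>K. p \<kappa> = 0"
      by (rule no_relation_over_coprime_powers[OF _ _ _ _ finK _ relation])
        (use assms(1) deg_p D(1) in auto)
    then show "\<forall>i\<in>K \<times> {..<D}. c i = 0"
      using coeff_p by (metis (no_types, lifting) SigmaE coeff_0 lessThan_iff)
  qed
  moreover have "card (K \<times> {..<D}) = D * (\<Sum>\<gamma>\<le>N. N - \<gamma> + 1)"
    unfolding card_cartesian_product K_def by (subst card_SigmaI) simp_all
  ultimately show ?thesis by simp
qed

theorem corollary3p3:
  fixes d :: nat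
  assumes "d \<ge> 3"
  shows "ideal_degree d (vanishing_ideal d (ig_moment_variety d)) = (of_nat d - 1)^2"
proof -
  define D where "D = (d - 1) ^ 2"
  \<comment> \<open>The degree taken up by the \<open>D - 1\<close> quadrics of the lower bound; the
    remaining degree is \<open>N = n - c\<close>.\<close>
  define c where "c = 2 * (D - 1)"
  have D: "rat_of_nat D = (of_nat d - 1) ^ 2" "D \<ge> 1"
    using assms by (simp_all add: D_def of_nat_diff)
  have bound: "\<bar>rat_of_nat (hilbert_function d (ig_ideal d) n) - (of_nat d - 1) ^ 2 / 2 * of_nat n ^ 2\<bar> \<le>
      (of_nat D * of_nat c + of_nat d) * of_nat n + 1" if n: "n \<ge> c" for n
  proof -
  define h where "h = rat_of_nat (hilbert_function d (ig_ideal d) n)"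
  have upper: "h \<le> of_nat D / 2 * of_nat n ^ 2 + of_nat d * of_nat n + 1"
    unfolding h_def D(1) by (rule hilbert_function_upper) (use assms in simp)
  define N where "N = n - c"
  have "D * (\<Sum>\<gamma>\<le>N. N - \<gamma> + 1) \<le> hilbert_function d (ig_ideal d) (N + c)"
    unfolding c_def using assms by (intro hilbert_function_lower) (simp_all add: D_def)
  also have "(\<Sum>\<gamma>\<le>N. N - \<gamma> + 1) = (\<Sum>\<gamma>\<le>N. \<gamma> + 1)"
    by (rule sum.reindex_bij_witness[of _ "\<lambda>\<gamma>. N - \<gamma>" "\<lambda>\<gamma>. N - \<gamma>"]) auto
  finally have "rat_of_nat (D * (\<Sum>\<gamma>\<le>N. \<gamma> + 1)) \<le> h"
    using n unfolding h_def of_nat_le_iff by (simp add: N_def)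
  moreover have "rat_of_nat (\<Sum>\<gamma>\<le>k. \<gamma> + 1) = (of_nat k + 1) * (of_nat k + 2) / 2" for k
    by (induction k) (simp_all add: field_simps)
  ultimately have "of_nat D * ((of_nat N + 1) * (of_nat N + 2) / 2) \<le> h"
    by (simp only: of_nat_mult)
  moreover have "rat_of_nat N = of_nat n - of_nat c"
    using n by (simp add: N_def of_nat_diff)
  ultimately have lower: "of_nat D / 2 * ((of_nat n - of_nat c + 1) * (of_nat n - of_nat c + 2)) \<le> h"
    by (simp add: algebra_simps)
  \<comment> \<open>This is the constant term of (n - c + 1) (n - c + 2) as a polynomial in n. It is
    nonnegative as no integer lies strictly between 1 and 2, so it may be dropped together with 3
    n.\<close>
  have "(0 :: rat) \<le> (of_nat c - 1) * (of_nat c - 2)"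
  proof (cases "c \<ge> 2")
    case False
    then have "c = 0 \<or> c = 1" by auto
    then show ?thesis by auto
  qed (auto intro!: mult_nonneg_nonneg)
  then have "of_nat n ^ 2 - 2 * of_nat c * of_nat n \<le> (of_nat n - of_nat c + 1) * (of_nat n - of_nat c + (2 :: rat))"
    by (simp add: algebra_simps power2_eq_square)
  then have "of_nat D / 2 * (of_nat n ^ 2 - 2 * of_nat c * of_nat n) \<le> h"
    using lower by (meson mult_left_mono order_trans of_nat_0_le_iff divide_nonneg_pos zero_less_numeral)
  then have "of_nat D / 2 * of_nat n ^ 2 - h \<le> of_nat D * of_nat c * of_nat n"
    by (simp add: algebra_simps)
  moreover have "0 \<le> rat_of_nat D * of_nat c * of_nat n" "0 \<le> rat_of_nat d * of_nat n"
    by simp_all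
  ultimately show ?thesis
    using upper unfolding h_def[symmetric] D(1)[symmetric] abs_le_iff distrib_right by linarith
  qed
  have "(0 :: rat) < (of_nat d - 1) ^ 2" using assms by simp
  then show ?thesis
    by (rule ideal_degree_eqI[OF eventually_poly_hilbert_function _ bound])
qed

end
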